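(* Let $s\ge0$. Assume that $A:\mathbb T^n\to\mathbb R$ satisfies $0<\alpha_0\le A(\boldsymbol y)\le\alpha_1<\infty$ for all $\boldsymbol y\in\mathbb T^n$, and that its Fourier coefficients satisfy $|\widehat A_{\boldsymbol k}|\le C_A(1+|\boldsymbol k|)^{-N}$ for all $\boldsymbol k\in\mathbb Z^n$, with $C_A>0$ independent of $\boldsymbol k$ and $N>n+s+\tau$. Assume that $P$ satisfies the Diophantine condition: there are constants $c>0$, $\tau>0$ (the same $\tau$ as in the condition $N>n+s+\tau$ on the decay of the Fourier coefficients of $A$) such that $$|P\boldsymbol k|\ge c|\boldsymbol k|^{-\tau}\qquad\forall\boldsymbol k\in\mathbb Z^n\setminus\{\boldsymbol 0\}.$$ Then for any $F\in H_0^{2\tau+s}(\mathbb T^n)$ there exists a unique solution $U\in H_0^s(\mathbb T^n)$ of the variational problem: find $U\in\overline H_{P,0}^1(\mathbb T^n)$ such that $$a(U,V)=\langle F,V\rangle\qquad\forall V\in\overline H_{P,0}^1(\mathbb T^n).$$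
   Context: Let $d,n\ge1$ be integers and let $P\in\mathbb R^{d\times n}$ have columns that are linearly independent over $\mathbb Q$ (hence $P\boldsymbol k\ne0$ for $\boldsymbol k\in\mathbb Z^n\setminus\{\boldsymbol 0\}$). Let $\mathbb T^n=(\mathbb R/2\pi\mathbb Z)^n$. A formal Fourier series $U=\sum_{\boldsymbol k\in\mathbb Z^n}\widehat U_{\boldsymbol k}e^{\mathrm i\boldsymbol k^\top\boldsymbol y}$ is identified with its family of complex coefficients. For $s\in\mathbb R$, $\overline H_{P,0}^s(\mathbb T^n)$ is the Hilbert space of those $U$ with $\widehat U_{\boldsymbol 0}=0$ and $\|U\|_{\overline H_{P,0}^s}^2:=\sum_{\boldsymbol k\neq\boldsymbol 0}|P\boldsymbol k|^{2s}|\widehat U_{\boldsymbol k}|^2<\infty$, and $H_0^s(\mathbb T^n)$ is the space of those $U$ with $\widehat U_{\boldsymbol 0}=0$ and $\|U\|_{H^s}^2:=\sum_{\boldsymbol k\ne\boldsymbol 0}(1+|\boldsymbol k|^2)^s|\widehat U_{\boldsymbol k}|^2<\infty$. The form is $a(U,V)=(AP\nabla U,P\nabla V)$, where $P\nabla U=\sum_{\boldsymbol k\ne\boldsymbol 0}\mathrm i\,P\boldsymbol k\,\widehat U_{\boldsymbol k}e^{\mathrm i\boldsymbol k^\top\boldsymbol y}\in L^2(\mathbb T^n)^d$ and $(\cdot,\cdot)$ is the $L^2(\mathbb T^n)$ inner product normalized so that the $e^{\mathrm i\boldsymbol k^\top\boldsymbol y}$ are orthonormal; $\langle F,V\rangle=\sum_{\boldsymbol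 k\ne\boldsymbol 0}\widehat F_{\boldsymbol k}\overline{\widehat V_{\boldsymbol k}}$. A solution $U\in H_0^s(\mathbb T^n)$ of the variational problem means an element of $H_0^s(\mathbb T^n)\cap\overline H_{P,0}^1(\mathbb T^n)$ satisfying the variational identity. *)

theory Defs
  imports "HOL-Analysis.Analysis"
begin

text \<open>
  Functions on the torus are \<open>2\<pi>\<close>-periodic functions on \<open>real ^ 'n\<close>; integrals are taken over
  the fundamental cell \<open>[0, 2\<pi>]\<^sup>n\<close> against normalized Lebesgue measure, for which the characters
  are orthonormal.
\<close>

definition torus_periodic :: "(real ^ 'n \<Rightarrow> 'b) \<Rightarrow> bool" where
  "torus_periodic f \<longleftrightarrow> (\<forall>y i. f (y + axis i (2 * pi)) = f y)"

definition torus_measure :: "(real ^ 'n) measure" where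
  "torus_measure = uniform_measure lebesgue (cbox 0 (\<chi> i. 2 * pi))"

definition of_int_vec :: "int ^ 'n \<Rightarrow> real ^ 'n" where
  "of_int_vec k = (\<chi> i. real_of_int (k $ i))"

definition character :: "int ^ 'n \<Rightarrow> real ^ 'n \<Rightarrow> complex" where
  "character k y = exp (\<i> * of_real (of_int_vec k \<bullet> y))"

definition fourier_coeff :: "(real ^ 'n \<Rightarrow> complex) \<Rightarrow> int ^ 'n \<Rightarrow> complex" where
  "fourier_coeff f k = (LINT y|torus_measure. f y * cnj (character k y))"

text \<open>The index \<open>j\<close> ranges over the columns as a family, so repeated columns are dependent.\<close>

definition rat_independent_columns :: "real ^ 'n ^ 'd \<Rightarrow> bool" where
  "rat_independent_columns P \<longleftrightarrow>
     (\<forall>q :: 'n \<Rightarrow> rat. (\<Sum>j\<in>UNIV. real_of_rat (q j) *\<^sub>R column j P) = 0 \<longrightarrow> (\<forall>j. q j = 0))"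

text \<open>
  A formal Fourier series is its coefficient family \<open>int ^ 'n \<Rightarrow> complex\<close>.
\<close>

definition H_bar_0 :: "real ^ 'n ^ 'd \<Rightarrow> real \<Rightarrow> (int ^ 'n \<Rightarrow> complex) set" where
  "H_bar_0 P s = {U. U 0 = 0 \<and>
     (\<lambda>k. norm (P *v of_int_vec k) powr (2 * s) * (cmod (U k))\<^sup>2) summable_on (- {0})}"

definition H_0 :: "real \<Rightarrow> (int ^ 'n \<Rightarrow> complex) set" where
  "H_0 s = {U. U 0 = 0 \<and>
     (\<lambda>k. (1 + (norm (of_int_vec k))\<^sup>2) powr s * (cmod (U k))\<^sup>2) summable_on (- {0})}"

definition L2_torus :: "(real ^ 'n \<Rightarrow> complex ^ 'd) set" where
  "L2_torus = {g. g \<in> borel_measurable torus_measure \<and>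
     integrable torus_measure (\<lambda>y. (norm (g y))\<^sup>2)}"

definition L2_inner :: "(real ^ 'n \<Rightarrow> complex ^ 'd) \<Rightarrow> (real ^ 'n \<Rightarrow> complex ^ 'd) \<Rightarrow> complex" where
  "L2_inner f g = (LINT y|torus_measure. (\<Sum>j\<in>UNIV. f y $ j * cnj (g y $ j)))"

text \<open>
  \<open>L2_series c g\<close>: the series \<open>\<Sum>\<^sub>k c\<^sub>k e\<^bsup>i k\<cdot>y\<^esup>\<close> converges (unconditionally) to \<open>g\<close> in
  \<open>L\<^sup>2\<close>; this determines \<open>g\<close> up to a null set.
\<close>

definition L2_series :: "(int ^ 'n \<Rightarrow> complex ^ 'd) \<Rightarrow> (real ^ 'n \<Rightarrow> complex ^ 'd) \<Rightarrow> bool" where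
  "L2_series c g \<longleftrightarrow> g \<in> L2_torus \<and>
     ((\<lambda>K. LINT y|torus_measure. (norm (g y - (\<Sum>k\<in>K. character k y *s c k)))\<^sup>2)
        \<longlongrightarrow> 0) (finite_subsets_at_top (- {0}))"

text \<open>
  \<open>P\<nabla>U\<close> as an \<open>L\<^sup>2\<close> function: an arbitrary representative of the \<open>L\<^sup>2\<close> limit. It is meaningful for
  \<open>U \<in> H_bar_0 P 1\<close>, where the coefficients are square summable, and is only used there.
\<close>

definition P_grad :: "real ^ 'n ^ 'd \<Rightarrow> (int ^ 'n \<Rightarrow> complex) \<Rightarrow> real ^ 'n \<Rightarrow> complex ^ 'd" where
  "P_grad P U =
     (SOME g. L2_series (\<lambda>k. \<chi> j. \<i> * of_real ((P *v of_int_vec k) $ j) * U k) g)"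

definition form_a ::
  "(real ^ 'n \<Rightarrow> real) \<Rightarrow> real ^ 'n ^ 'd \<Rightarrow> (int ^ 'n \<Rightarrow> complex) \<Rightarrow> (int ^ 'n \<Rightarrow> complex) \<Rightarrow> complex"
  where
  "form_a A P U V = L2_inner (\<lambda>y. complex_of_real (A y) *s P_grad P U y) (P_grad P V)"

definition dual_pairing :: "(int ^ 'n \<Rightarrow> complex) \<Rightarrow> (int ^ 'n \<Rightarrow> complex) \<Rightarrow> complex" where
  "dual_pairing F V = (\<Sum>\<^sub>\<infinity>k\<in>- {0}. F k * cnj (V k))"

definition variational_solution ::
  "(real ^ 'n \<Rightarrow> real) \<Rightarrow> real ^ 'n ^ 'd \<Rightarrow> (int ^ 'n \<Rightarrow> complex) \<Rightarrow> (int ^ 'n \<Rightarrow> complex) \<Rightarrow> bool"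
  where
  "variational_solution A P F U \<longleftrightarrow>
     U \<in> H_bar_0 P 1 \<and> (\<forall>V\<in>H_bar_0 P 1. form_a A P U V = dual_pairing F V)"

end

theory Submission
  imports Defs
begin

text \<open>
  Put \<open>w\<^sub>k = |P k| U\<^sub>k\<close>, \<open>g\<^sub>k = F\<^sub>k / |P k|\<close> and \<open>e\<^sub>k = P k / |P k|\<close>. In these unknowns the variational
  problem reads \<open>M w = g\<close> on \<open>\<ell>\<^sup>2\<close>, where \<open>M\<^sub>k\<^sub>l = a\<^sub>k\<^sub>-\<^sub>l (e\<^sub>l \<bullet> e\<^sub>k)\<close> with \<open>a\<close> the
  Fourier coefficients of \<open>A\<close>. The matrix \<open>Q = 1 - M / \<alpha>\<^sub>1\<close> is a
  compression of multiplication by \<open>1 - A / \<alpha>\<^sub>1\<close>, hence a contraction with factor \<open>1 - \<alpha>\<^sub>0 / \<alpha>\<^sub>1\<close>.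
  Conjugating \<open>Q\<close> by the weight \<open>(1 + \<epsilon> |k|) powr (s + \<tau>)\<close> perturbs it by a matrix with entries of size
  \<open>((1 + \<epsilon> |k - l|) powr (s + \<tau>) - 1) (1 + |k - l|) powr (- N)\<close>; since \<open>N > n + s + \<tau>\<close>, Schur's test
  makes this perturbation small for small \<open>\<epsilon>\<close>. So the conjugated matrix is still a contraction, and its
  Neumann series solves \<open>M w = g\<close> with \<open>w\<close> of Sobolev regularity \<open>s + \<tau>\<close>. Dividing by \<open>|P k|\<close> costs \<open>\<tau>\<close>
  derivatives in passing from \<open>F\<close> to \<open>g\<close> and again from \<open>w\<close> to \<open>U\<close>.
\<close>

section \<open>Lattice sums and weights\<close>

lemma of_int_vec_0 [simp]: "of_int_vec 0 = 0"
  by (simp add: of_int_vec_def vec_eq_iff)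

lemma of_int_vec_diff: "of_int_vec (k - l) = of_int_vec k - of_int_vec l"
  by (simp add: of_int_vec_def vec_eq_iff)

lemma of_int_vec_eq_0_iff [simp]: "of_int_vec k = 0 \<longleftrightarrow> k = 0"
  by (simp add: of_int_vec_def vec_eq_iff)

section \<open>Convergence of lattice sums\<close>

lemma summable_on_int_powr:
  fixes r :: real
  assumes "r > 1"
  shows "(\<lambda>i::int. (1 + \<bar>real_of_int i\<bar>) powr (- r)) summable_on UNIV"
proof -
  have "summable (\<lambda>n::nat. (real n) powr (- r))"
    using assms by (simp add: summable_real_powr_iff)
  then have "summable (\<lambda>n::nat. (real (Suc n)) powr (- r))"
    by (rule summable_ignore_initial_segment[where k=1, simplified])
  then have s: "(\<lambda>n::nat. (1 + real n) powr (- r)) summable_on UNIV"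
    by (intro summable_nonneg_imp_summable_on) (auto simp: add.commute)
  have "(\<lambda>i::int. (1 + \<bar>real_of_int i\<bar>) powr (- r)) summable_on (range int)"
    by (subst summable_on_reindex) (use s in \<open>auto simp: o_def\<close>)
  moreover have "(\<lambda>i::int. (1 + \<bar>real_of_int i\<bar>) powr (- r)) summable_on (range (\<lambda>n. - int n))"
    by (subst summable_on_reindex) (use s in \<open>auto simp: o_def inj_def\<close>)
  moreover have "UNIV = range int \<union> range (\<lambda>n. - int n)"
  proof -
    have "i \<in> range int \<union> range (\<lambda>n. - int n)" for i :: int
      by (cases i rule: int_cases2) auto
    then show ?thesis by blast
  qed
  ultimately show ?thesis
    using summable_on_union by metis
qed

text \<open>The norm dominates every coordinate, so the summand is at most a product over the
  coordinates of one-dimensional terms with exponent \<open>r = p / CARD('n) > 1\<close>. Over a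
  finite box such products sum to a product of one-dimensional sums.\<close>

lemma summable_on_lattice_powr:
  fixes p :: real
  assumes p: "p > real CARD('n)"
  shows "(\<lambda>j::int^'n. (1 + norm (of_int_vec j)) powr (- p)) summable_on UNIV"
proof (rule nonneg_bdd_above_summable_on)
  define r where "r = p / real CARD('n)"
  define h where "h i = (1 + \<bar>real_of_int i\<bar>) powr (- r)" for i :: int
  have r: "r > 1" using p by (simp add: r_def field_simps)
  have h0: "h i \<ge> 0" for i by (simp add: h_def)
  have hs: "h summable_on UNIV"
    unfolding h_def by (rule summable_on_int_powr[OF r])
  have pt: "(1 + norm (of_int_vec j)) powr (- p) \<le> (\<Prod>i\<in>UNIV. h (j $ i))" for j :: "int^'n"
  proof -
    have "((1 + norm (of_int_vec j)) powr (- r)) ^ CARD('n) = (1 + norm (of_int_vec j)) powr (real CARD('n) * - r)"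
      by (rule powr_power) (use norm_ge_zero[of "of_int_vec j"] in linarith)
    also have "real CARD('n) * - r = - p" by (simp add: r_def)
    finally have "(1 + norm (of_int_vec j)) powr (- p) = (\<Prod>i\<in>(UNIV::'n set). (1 + norm (of_int_vec j)) powr (- r))"
      by simp
    also have "\<dots> \<le> (\<Prod>i\<in>UNIV. h (j $ i))"
    proof (rule prod_mono, safe)
      fix i
      have "\<bar>real_of_int (j $ i)\<bar> \<le> norm (of_int_vec j)"
        using component_le_norm_cart[of "of_int_vec j" i] by (simp add: of_int_vec_def)
      then show "(1 + norm (of_int_vec j)) powr (- r) \<le> h (j $ i)"
        unfolding h_def using r by (intro powr_mono2') auto
    qed simp
    finally show ?thesis .
  qed
  show "bdd_above (sum (\<lambda>j::int^'n. (1 + norm (of_int_vec j)) powr (- p)) ` {F. F \<subseteq> UNIV \<and> finite F})"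
  proof (rule bdd_aboveI2)
    fix J :: "(int^'n) set" assume "J \<in> {F. F \<subseteq> UNIV \<and> finite F}"
    then have J: "finite J" by simp
    \<comment> \<open>Every coordinate of every point of \<open>J\<close> lies in \<open>B\<close>,
      so \<open>J\<close> sits inside the box all of whose sides are \<open>B\<close>.\<close>
    define B where "B = (\<Union>i. (\<lambda>j. j $ i) ` J)"
    have B: "finite B" unfolding B_def using J by auto
    have "(\<Sum>j\<in>J. (1 + norm (of_int_vec j)) powr (- p)) \<le> (\<Sum>j\<in>J. \<Prod>i\<in>UNIV. h (j $ i))"
      by (intro sum_mono pt)
    also have "\<dots> = (\<Sum>g\<in>(\<lambda>j i. j $ i) ` J. \<Prod>i\<in>UNIV. h (g i))"
      by (subst sum.reindex) (auto simp: inj_on_def vec_eq_iff fun_eq_iff)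
    also have "\<dots> \<le> (\<Sum>g\<in>PiE UNIV (\<lambda>_::'n. B). \<Prod>i\<in>UNIV. h (g i))"
      using B by (intro sum_mono2 finite_PiE) (auto simp: B_def PiE_iff h0 prod_nonneg)
    also have "\<dots> = (\<Prod>i\<in>(UNIV::'n set). \<Sum>b\<in>B. h b)"
      using B by (subst prod_sum_PiE) auto
    also have "\<dots> \<le> (\<Prod>i\<in>(UNIV::'n set). infsum h UNIV)"
      by (intro prod_mono conjI sum_nonneg h0 finite_sum_le_infsum hs B) auto
    finally show "(\<Sum>j\<in>J. (1 + norm (of_int_vec j)) powr (- p)) \<le> (\<Prod>i\<in>(UNIV::'n set). infsum h UNIV)" .
  qed
qed simp

text \<open>Split at \<open>\<epsilon> r = \<surd>\<epsilon>\<close>.\<close>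

lemma powr_weight_defect_le:
  fixes \<epsilon> r \<sigma> \<theta> :: real
  assumes "0 < \<epsilon>" "\<epsilon> \<le> 1" "r \<ge> 0" "\<sigma> \<ge> 0" "\<theta> \<ge> 0"
  shows "(1 + \<epsilon> * r) powr \<sigma> - 1
    \<le> ((1 + sqrt \<epsilon>) powr \<sigma> - 1 + \<epsilon> powr (\<theta> / 2)) * (1 + r) powr (\<sigma> + \<theta>)"
proof -
  have one: "(1 + sqrt \<epsilon>) powr \<sigma> \<ge> 1" using assms by (intro ge_one_powr_ge_zero) auto
  have sq: "sqrt \<epsilon> * sqrt \<epsilon> = \<epsilon>" using assms by simp
  show ?thesis
  proof (cases "\<epsilon> * r \<le> sqrt \<epsilon>")
    case True
    have "(1 + \<epsilon> * r) powr \<sigma> - 1 \<le> ((1 + sqrt \<epsilon>) powr \<sigma> - 1) * 1"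
      using True assms by (simp add: powr_mono2)
    also have "\<dots> \<le> ((1 + sqrt \<epsilon>) powr \<sigma> - 1 + \<epsilon> powr (\<theta> / 2)) * (1 + r) powr (\<sigma> + \<theta>)"
      using one assms by (intro mult_mono ge_one_powr_ge_zero) auto
    finally show ?thesis .
  next
    case False
    then have "sqrt \<epsilon> * (sqrt \<epsilon> * r) > sqrt \<epsilon> * 1"
      using sq by (simp add: mult.assoc[symmetric])
    then have "sqrt \<epsilon> * r > 1" using assms by (simp del: mult_1_right)
    then have g: "1 \<le> sqrt \<epsilon> * (1 + r)" using assms by (simp add: distrib_left add_increasing)
    have "(1 + \<epsilon> * r) powr \<sigma> - 1 \<le> (1 + r) powr \<sigma>"
    proof -
      have "(1 + \<epsilon> * r) powr \<sigma> \<le> (1 + r) powr \<sigma>"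
        using assms by (intro powr_mono2) (auto simp: mult_left_le_one_le)
      then show ?thesis by simp
    qed
    \<comment> \<open>Here \<open>sqrt \<epsilon> * (1 + r)\<close> is at least 1, so its power
      \<open>\<theta>\<close> can be inserted; it supplies the small factor
      \<open>\<epsilon> powr (\<theta> / 2)\<close>.\<close>
    also have "\<dots> \<le> (sqrt \<epsilon> * (1 + r)) powr \<theta> * (1 + r) powr \<sigma>"
      using ge_one_powr_ge_zero[OF g \<open>\<theta> \<ge> 0\<close>] by (simp add: mult_le_cancel_right1)
    also have "\<dots> = \<epsilon> powr (\<theta> / 2) * (1 + r) powr (\<sigma> + \<theta>)"
      using assms by (simp add: powr_mult powr_add powr_half_sqrt[symmetric] powr_powr mult_ac)
    also have "\<dots> \<le> ((1 + sqrt \<epsilon>) powr \<sigma> - 1 + \<epsilon> powr (\<theta> / 2)) * (1 + r) powr (\<sigma> + \<theta>)"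
      using one by (intro mult_right_mono) auto
    finally show ?thesis .
  qed
qed

text \<open>The spare decay \<open>N - CARD('n) - \<sigma>\<close> is halved: one half,
  \<open>\<theta>\<close>, pays for a prefactor \<open>\<eta> \<epsilon>\<close> that tends to 0
  with \<open>\<epsilon>\<close>, the other keeps the remaining lattice sum \<open>W\<close> finite.
  The resulting sum later serves as Schur constant of the perturbation caused by the
  weights.\<close>

lemma exists_small_weight_defect:
  fixes C N \<sigma> \<delta> :: real
  assumes "C \<ge> 0" "\<sigma> \<ge> 0" "N > real CARD('n) + \<sigma>" "\<delta> > 0"
  obtains \<epsilon> where "0 < \<epsilon>" "\<epsilon> \<le> 1"
    "(\<lambda>j::int^'n. ((1 + \<epsilon> * norm (of_int_vec j)) powr \<sigma> - 1) * (C * (1 + norm (of_int_vec j)) powr (- N)))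
       summable_on UNIV"
    "(\<Sum>\<^sub>\<infinity>j::int^'n. ((1 + \<epsilon> * norm (of_int_vec j)) powr \<sigma> - 1) * (C * (1 + norm (of_int_vec j)) powr (- N))) \<le> \<delta>"
proof -
  define \<theta> where "\<theta> = (N - real CARD('n) - \<sigma>) / 2"
  have \<theta>: "\<theta> > 0" using assms by (simp add: \<theta>_def)
  define \<eta> where "\<eta> \<epsilon> = (1 + sqrt \<epsilon>) powr \<sigma> - 1 + \<epsilon> powr (\<theta> / 2)" for \<epsilon> :: real
  define w where "w j = C * (1 + norm (of_int_vec j)) powr (- (N - \<sigma> - \<theta>))" for j :: "int^'n"
  have "N - \<sigma> - \<theta> > real CARD('n)" using \<theta> by (simp add: \<theta>_def field_simps)
  then have ws: "w summable_on UNIV"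
    unfolding w_def by (intro summable_on_cmult_right summable_on_lattice_powr)
  have w0: "w j \<ge> 0" for j using assms by (simp add: w_def)
  define W where "W = infsum w UNIV"
  have W0: "W \<ge> 0" unfolding W_def by (intro infsum_nonneg w0)
  have "(\<eta> \<longlongrightarrow> \<eta> 0) (at_right 0)"
  proof -
    have "((\<lambda>\<epsilon>. \<epsilon> powr (\<theta> / 2)) \<longlongrightarrow> 0 powr (\<theta> / 2)) (at_right (0::real))"
      using \<theta> eventually_at_right_less[of "0::real"]
      by (intro tendsto_powr' tendsto_const tendsto_ident_at) (auto elim: eventually_mono)
    moreover have "((\<lambda>\<epsilon>. (1 + sqrt \<epsilon>) powr \<sigma> - 1) \<longlongrightarrow> (1 + sqrt 0) powr \<sigma> - 1) (at_right (0::real))"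
      by (intro tendsto_diff tendsto_add tendsto_powr tendsto_const tendsto_real_sqrt tendsto_ident_at) simp
    ultimately have "((\<lambda>\<epsilon>. (1 + sqrt \<epsilon>) powr \<sigma> - 1 + \<epsilon> powr (\<theta> / 2)) \<longlongrightarrow> (1 + sqrt 0) powr \<sigma> - 1 + 0 powr (\<theta> / 2)) (at_right 0)"
      by (rule tendsto_add[rotated])
    then show ?thesis
      unfolding \<eta>_def[abs_def] .
  qed
  moreover have "\<eta> 0 = 0" using \<theta> by (simp add: \<eta>_def)
  ultimately have "((\<lambda>\<epsilon>. \<eta> \<epsilon> * W) \<longlongrightarrow> 0 * W) (at_right 0)"
    by (intro tendsto_mult) auto
  then have "\<forall>\<^sub>F \<epsilon> in at_right 0. \<eta> \<epsilon> * W < \<delta>"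
    using assms by (intro order_tendstoD) auto
  moreover have "\<forall>\<^sub>F \<epsilon> in at_right (0::real). 0 < \<epsilon>" by (rule eventually_at_right_less)
  moreover have "\<forall>\<^sub>F \<epsilon> in at_right (0::real). \<epsilon> < 1"
    by (rule eventually_at_rightI[of 0 1]) auto
  ultimately have "\<forall>\<^sub>F \<epsilon> in at_right 0. \<eta> \<epsilon> * W < \<delta> \<and> 0 < \<epsilon> \<and> \<epsilon> < 1"
    by (simp add: eventually_conj_iff)
  then obtain \<epsilon> where e: "\<eta> \<epsilon> * W < \<delta>" "0 < \<epsilon>" "\<epsilon> < 1"
    using eventually_happens'[OF trivial_limit_at_right_real] by blast
  let ?f = "\<lambda>j::int^'n. ((1 + \<epsilon> * norm (of_int_vec j)) powr \<sigma> - 1) * (C * (1 + norm (of_int_vec j)) powr (- N))"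
  have f0: "?f j \<ge> 0" for j
    using assms e by (intro mult_nonneg_nonneg) (auto intro!: ge_one_powr_ge_zero)
  have fw: "?f j \<le> \<eta> \<epsilon> * w j" for j
  proof -
    have "?f j \<le> (\<eta> \<epsilon> * (1 + norm (of_int_vec j)) powr (\<sigma> + \<theta>)) * (C * (1 + norm (of_int_vec j)) powr (- N))"
      unfolding \<eta>_def using assms e \<theta> by (intro mult_right_mono powr_weight_defect_le) auto
    also have "\<dots> = \<eta> \<epsilon> * (C * ((1 + norm (of_int_vec j)) powr (\<sigma> + \<theta>) * (1 + norm (of_int_vec j)) powr (- N)))"
      by (simp add: mult_ac)
    also have "\<dots> = \<eta> \<epsilon> * w j"
      by (simp add: w_def powr_add[symmetric] algebra_simps)
    finally show ?thesis .
  qed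
  have fs: "?f summable_on UNIV"
    by (rule summable_on_comparison_test[OF summable_on_cmult_right[OF ws] fw f0])
  have "infsum ?f UNIV \<le> infsum (\<lambda>j. \<eta> \<epsilon> * w j) UNIV"
    by (intro infsum_mono fs fw summable_on_cmult_right ws)
  also have "\<dots> = \<eta> \<epsilon> * W" by (simp add: infsum_cmult_right' W_def)
  also have "\<dots> \<le> \<delta>" using e by simp
  finally show ?thesis using that[of \<epsilon>] e fs by simp
qed

section \<open>Fourier analysis on the torus\<close>

lemma two_pi_inner_Basis:
  assumes "b \<in> Basis"
  shows "(\<chi> i. 2 * pi) \<bullet> (b :: real^'n) = 2 * pi"
  using assms by (auto simp: Basis_vec_def inner_axis)

lemma emeasure_torus_cell:
  "emeasure lebesgue (cbox 0 (\<chi> i. 2 * pi) :: (real^'n) set) = ennreal ((2 * pi) ^ CARD('n))"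
proof -
  have "emeasure lborel (cbox 0 (\<chi> i. 2 * pi) :: (real^'n) set) = ennreal (\<Prod>b\<in>(Basis::(real^'n) set). 2 * pi)"
    by (subst emeasure_lborel_cbox) (auto simp: two_pi_inner_Basis)
  then show ?thesis by simp
qed

lemma sets_torus_measure [simp, measurable_cong]: "sets torus_measure = sets lebesgue"
  by (simp add: torus_measure_def uniform_measure_def)

lemma space_torus_measure [simp]: "space torus_measure = UNIV"
  by (simp add: torus_measure_def uniform_measure_def)

lemma emeasure_torus_measure_UNIV: "emeasure (torus_measure :: (real^'n) measure) UNIV = 1"
proof -
  have "emeasure (torus_measure :: (real^'n) measure) (space lebesgue) = 1"
    unfolding torus_measure_def
    by (subst emeasure_uniform_measure) (auto simp: emeasure_torus_cell ennreal_divide_self)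
  then show ?thesis by simp
qed

lemma finite_measure_torus: "finite_measure (torus_measure :: (real^'n) measure)"
  by (rule finite_measureI) (simp add: emeasure_torus_measure_UNIV)

lemma measure_torus_measure_UNIV [simp]: "measure (torus_measure :: (real^'n) measure) UNIV = 1"
  by (simp add: measure_def emeasure_torus_measure_UNIV)

lemma integral_torus_measure:
  fixes f :: "real^'n \<Rightarrow> 'b :: {banach, second_countable_topology}"
  assumes f: "f \<in> borel_measurable lebesgue"
  shows "(LINT y|torus_measure. f y)
    = (1 / (2 * pi) ^ CARD('n)) *\<^sub>R (LINT y|lebesgue. indicator (cbox 0 (\<chi> i. 2 * pi)) y *\<^sub>R f y)"
proof -
  have *: "torus_measure = density lebesgue (\<lambda>y. ennreal (indicator (cbox 0 (\<chi> i. 2 * pi) :: (real^'n) set) y / (2 * pi) ^ CARD('n)))"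
    unfolding torus_measure_def uniform_measure_def emeasure_torus_cell
    by (intro arg_cong[where f="density lebesgue"] ext)
      (simp add: divide_ennreal[symmetric] ennreal_indicator)
  have "(LINT y|torus_measure. f y) = (LINT y|lebesgue. (indicator (cbox 0 (\<chi> i. 2 * pi)) y / (2 * pi) ^ CARD('n)) *\<^sub>R f y)"
    unfolding * by (rule integral_density[OF f])
      (auto intro!: borel_measurable_divide borel_measurable_indicator)
  also have "\<dots> = (LINT y|lebesgue. (1 / (2 * pi) ^ CARD('n)) *\<^sub>R (indicator (cbox 0 (\<chi> i. 2 * pi)) y *\<^sub>R f y))"
    by (intro Bochner_Integration.integral_cong) auto
  finally show ?thesis by (simp only: integral_scaleR_right)
qed

section \<open>Characters and their orthonormality\<close>

lemma norm_character [simp]: "cmod (character k y) = 1"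
  unfolding character_def by (simp only: norm_exp_i_times)

lemma character_0 [simp]: "character 0 y = 1"
  by (simp add: character_def)

lemma character_mult_cnj: "character k y * cnj (character l y) = character (k - l) y"
  by (simp add: character_def of_int_vec_diff exp_cnj exp_add[symmetric] inner_diff_left algebra_simps)

lemma continuous_on_character: "continuous_on S (character k)"
  unfolding character_def by (intro continuous_intros)

lemma borel_measurable_lebesgue_continuous:
  fixes f :: "real^'n \<Rightarrow> 'b :: topological_space"
  assumes "continuous_on UNIV f"
  shows "f \<in> borel_measurable lebesgue"
  by (rule measurable_completion) (use borel_measurable_continuous_onI[OF assms] in simp)

lemma integral_exp_int_period:
  assumes "m \<noteq> 0"
  shows "(LINT t|lborel. indicator {0..2 * pi} t *\<^sub>R exp (\<i> * of_real (of_int m * t))) = (0 :: complex)"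
proof -
  let ?F = "\<lambda>t. exp (\<i> * of_real (of_int m * t)) / (\<i> * of_int m) :: complex"
  have e: "exp (\<i> * of_real (of_int m * (2 * pi))) = (1 :: complex)"
    using exp_plus_2pin[of 0 m] by (simp add: mult_ac)
  have "(LINT t|lborel. indicator {0..2 * pi} t *\<^sub>R exp (\<i> * of_real (of_int m * t))) = ?F (2 * pi) - ?F 0"
  proof (rule integral_FTC_Icc)
    fix t :: real
    have "((\<lambda>z. exp (\<i> * (of_int m * z)) / (\<i> * of_int m)) has_field_derivative exp (\<i> * (of_int m * of_real t))) (at (of_real t))"
      using assms by (auto intro!: derivative_eq_intros simp: mult_ac)
    from has_vector_derivative_real_field[OF this]
    show "(?F has_vector_derivative exp (\<i> * of_real (of_int m * t))) (at t within {0..2 * pi})"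
      by (simp add: has_vector_derivative_at_within)
  qed (auto intro!: continuous_intros)
  also have "\<dots> = 0" by (simp only: e) simp
  finally show ?thesis .
qed

text \<open>On the cell a character is a product of functions of single coordinates, so its integral
  is a product of one-dimensional integrals. A coordinate with \<open>k $ i \<noteq> 0\<close>
  contributes the integral of a nonconstant exponential over full periods, which is 0.\<close>

lemma integral_character:
  "(LINT y|torus_measure. character (k :: int^'n) y) = (if k = 0 then 1 else 0)"
proof (cases "k = 0")
  case False
  then obtain i where i: "k $ i \<noteq> 0" by (auto simp: vec_eq_iff)
  define b :: "real^'n" where "b = axis i 1"
  have b: "b \<in> Basis" by (auto simp: b_def Basis_vec_def)
  define g where "g c t = indicator {0..2 * pi} t *\<^sub>R exp (\<i> * of_real ((of_int_vec k \<bullet> c) * t))"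
    for c :: "real^'n" and t :: real
  have gb: "g b = (\<lambda>t. indicator {0..2 * pi} t *\<^sub>R exp (\<i> * of_real (of_int (k $ i) * t)))"
    by (simp add: g_def b_def fun_eq_iff inner_axis of_int_vec_def)
  have g_meas: "g c \<in> borel_measurable borel" for c
    unfolding g_def by (intro borel_measurable_scaleR borel_measurable_indicator
        borel_measurable_continuous_onI continuous_intros) auto
  have gint: "integrable lborel (g c)" for c
  proof -
    have "integrable lborel (\<lambda>t. indicator {0..2 * pi} t *\<^sub>R exp (\<i> * of_real ((of_int_vec k \<bullet> c) * t)))"
      by (rule borel_integrable_compact) (auto intro!: continuous_intros)
    then show ?thesis by (simp add: g_def[abs_def])
  qed
  have split: "indicator (cbox 0 (\<chi> i. 2 * pi)) y *\<^sub>R character k y = (\<Prod>c\<in>Basis. g c (y \<bullet> c))" for y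
  proof -
    have "character k y = (\<Prod>c\<in>Basis. exp (\<i> * of_real ((of_int_vec k \<bullet> c) * (y \<bullet> c))))"
      unfolding character_def euclidean_inner[of "of_int_vec k" y]
      by (simp add: exp_sum[symmetric] sum_distrib_left)
    moreover have "indicator (cbox 0 (\<chi> i. 2 * pi)) y = (\<Prod>c\<in>Basis. indicator {0..2 * pi} (y \<bullet> c) :: real)"
      by (auto simp: indicator_def mem_box two_pi_inner_Basis prod_zero_iff)
    ultimately show ?thesis
      by (simp add: g_def scaleR_conv_of_real prod.distrib)
  qed
  have meas: "(\<lambda>y. \<Prod>c\<in>Basis. g c (y \<bullet> c)) \<in> borel_measurable (borel :: (real^'n) measure)"
    by (intro borel_measurable_prod measurable_compose[OF _ g_meas]) auto
  interpret product_sigma_finite "\<lambda>_::real^'n. lborel :: real measure" ..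
  have "(LINT y|lebesgue. (\<Prod>c\<in>Basis. g c (y \<bullet> c))) = (LINT y|lborel. (\<Prod>c\<in>Basis. g c (y \<bullet> c)))"
    using meas by (intro integral_completion) simp
  \<comment> \<open>\<open>lborel_eq\<close> presents Lebesgue measure as the image of the product
    measure on coordinate families, where integrals of products factorize.\<close>
  also have "\<dots> = (LINT f|(\<Pi>\<^sub>M c\<in>(Basis::(real^'n) set). lborel). (\<Prod>c\<in>Basis. g c ((\<Sum>b\<in>Basis. f b *\<^sub>R b) \<bullet> c)))"
    by (subst lborel_eq, subst integral_distr) (use meas in auto)
  also have "\<dots> = (LINT f|(\<Pi>\<^sub>M c\<in>(Basis::(real^'n) set). lborel). (\<Prod>c\<in>Basis. g c (f c)))"
    by (intro Bochner_Integration.integral_cong prod.cong) auto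
  also have "\<dots> = (\<Prod>c\<in>Basis. LINT t|lborel. g c t)"
    by (rule product_integral_prod) (auto intro: gint)
  also have "\<dots> = 0"
  proof (rule prod_zero)
    have "(LINT t|lborel. g b t) = 0" unfolding gb by (rule integral_exp_int_period[OF i])
    then show "\<exists>c\<in>Basis. (LINT t|lborel. g c t) = 0" using b by blast
  qed simp
  finally have "(LINT y|lebesgue. (\<Prod>c\<in>Basis. g c (y \<bullet> c))) = 0" .
  then show ?thesis
    using False
    by (simp add: integral_torus_measure borel_measurable_lebesgue_continuous continuous_on_character split)
qed simp

text \<open>The Hermitian product on complex vectors; the operation \<open>\<bullet>\<close> on this
  type is only its real part.\<close>

definition herm :: "complex ^ 'd \<Rightarrow> complex ^ 'd \<Rightarrow> complex" where
  "herm u v = (\<Sum>j\<in>UNIV. u $ j * cnj (v $ j))"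

lemma norm_herm_le: "cmod (herm u v) \<le> norm u * norm v"
proof -
  have "cmod (herm u v) \<le> (\<Sum>j\<in>UNIV. \<bar>cmod (u $ j)\<bar> * \<bar>cmod (v $ j)\<bar>)"
    unfolding herm_def by (rule order_trans[OF norm_sum]) (simp add: norm_mult)
  also have "\<dots> \<le> norm u * norm v"
    unfolding norm_vec_def by (rule L2_set_mult_ineq)
  finally show ?thesis .
qed

lemma herm_self: "herm u u = of_real ((norm u)\<^sup>2)"
  by (simp add: herm_def norm_vec_def L2_set_def sum_nonneg complex_norm_square[symmetric])

lemma herm_diff_left: "herm (u - u') v = herm u v - herm u' v"
  by (simp add: herm_def left_diff_distrib sum_subtractf)

lemma herm_diff_right: "herm u (v - v') = herm u v - herm u v'"
  by (simp add: herm_def right_diff_distrib sum_subtractf)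

lemma herm_scale: "herm (a *s u) (b *s v) = a * cnj b * herm u v"
  by (simp add: herm_def sum_distrib_left mult_ac)

lemma herm_sum_left: "herm (\<Sum>k\<in>K. f k) v = (\<Sum>k\<in>K. herm (f k) v)"
  by (simp add: herm_def sum_distrib_right) (rule sum.swap)

lemma herm_sum_right: "herm u (\<Sum>k\<in>K. f k) = (\<Sum>k\<in>K. herm u (f k))"
  by (simp add: herm_def sum_distrib_left) (rule sum.swap)

lemma continuous_on_herm [continuous_intros]:
  assumes "continuous_on S f" "continuous_on S g"
  shows "continuous_on S (\<lambda>y. herm (f y) (g y))"
  unfolding herm_def using assms by (intro continuous_intros)

lemma borel_measurable_herm [measurable]:
  fixes f g :: "'a \<Rightarrow> complex ^ 'd"
  assumes [measurable]: "f \<in> borel_measurable M" "g \<in> borel_measurable M"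
  shows "(\<lambda>y. herm (f y) (g y)) \<in> borel_measurable M"
proof -
  have "(\<lambda>p :: (complex ^ 'd) \<times> (complex ^ 'd). herm (fst p) (snd p)) \<in> borel_measurable borel"
    by (intro borel_measurable_continuous_onI continuous_intros)
  then have "(\<lambda>p :: (complex ^ 'd) \<times> (complex ^ 'd). herm (fst p) (snd p)) \<in> borel_measurable (borel \<Otimes>\<^sub>M borel)"
    by (simp add: borel_prod)
  from measurable_compose[OF _ this, of "\<lambda>y. (f y, g y)" M] show ?thesis by simp
qed

section \<open>Trigonometric polynomials with vector coefficients\<close>

definition trig :: "(int ^ 'n \<Rightarrow> complex ^ 'd) \<Rightarrow> (int ^ 'n) set \<Rightarrow> real ^ 'n \<Rightarrow> complex ^ 'd" where
  "trig u K y = (\<Sum>k\<in>K. character k y *s u k)"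

lemma continuous_on_trig: "continuous_on S (trig u K)"
proof -
  have "trig u K = (\<lambda>y. \<Sum>k\<in>K. \<chi> j. character k y * u k $ j)"
    by (simp add: trig_def fun_eq_iff vec_eq_iff)
  moreover have "continuous_on S (\<lambda>y. \<Sum>k\<in>K. \<chi> j. character k y * u k $ j)"
    by (intro continuous_intros continuous_on_vec_lambda continuous_on_character)
  ultimately show ?thesis by simp
qed

lemma borel_measurable_trig [measurable]: "trig u K \<in> borel_measurable torus_measure"
  using borel_measurable_lebesgue_continuous[OF continuous_on_trig]
  by (simp cong: measurable_cong_sets)

lemma borel_measurable_character [measurable]: "character k \<in> borel_measurable torus_measure"
  using borel_measurable_lebesgue_continuous[OF continuous_on_character]
  by (simp cong: measurable_cong_sets)

lemma integrable_torus_bounded: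
  fixes f :: "real^'n \<Rightarrow> 'b :: {banach, second_countable_topology}"
  assumes "f \<in> borel_measurable torus_measure" "\<And>y. norm (f y) \<le> B"
  shows "integrable torus_measure f"
  using finite_measure.integrable_const_bound[OF finite_measure_torus, of f B] assms by simp

lemma cnj_character: "cnj (character k y) = character (- k) y"
  using character_mult_cnj[of 0 y k] by simp

lemma herm_trig:
  fixes y :: "real^'n" and u v :: "int^'n \<Rightarrow> complex^'d"
  shows "herm (trig u L y) (trig v K y) = (\<Sum>k\<in>K. \<Sum>l\<in>L. cnj (character (k - l) y) * herm (u l) (v k))"
proof -
  have c: "cnj (character (k - l) y) = character l y * cnj (character k y)" for k l
    by (simp add: character_mult_cnj[of l y k] cnj_character[of "k - l"])
  show ?thesis
    unfolding trig_def by (simp add: herm_sum_left herm_sum_right herm_scale c)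
qed

text \<open>On coefficients, multiplication by \<open>B\<close> acts as the matrix
  \<open>fourier_coeff B (k - l)\<close>. Bounds for that matrix can therefore be read off from
  pointwise bounds on \<open>B\<close>.\<close>

lemma integral_herm_trig:
  fixes B :: "real^'n \<Rightarrow> complex"
  assumes B: "integrable torus_measure B"
  shows "(LINT y|torus_measure. B y * herm (trig u L y) (trig v K y))
    = (\<Sum>k\<in>K. \<Sum>l\<in>L. fourier_coeff B (k - l) * herm (u l) (v k))"
proof -
  have [measurable]: "B \<in> borel_measurable torus_measure" using B by auto
  have int: "integrable torus_measure (\<lambda>y. B y * cnj (character m y))" for m
    by (rule Bochner_Integration.integrable_bound[OF B]) (auto simp: norm_mult cnj_character)
  have "(LINT y|torus_measure. B y * herm (trig u L y) (trig v K y))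
      = (LINT y|torus_measure. (\<Sum>k\<in>K. \<Sum>l\<in>L. (B y * cnj (character (k - l) y)) * herm (u l) (v k)))"
    by (simp add: herm_trig sum_distrib_left mult.assoc)
  also have "\<dots> = (\<Sum>k\<in>K. \<Sum>l\<in>L. fourier_coeff B (k - l) * herm (u l) (v k))"
    using int by (simp add: Bochner_Integration.integral_sum fourier_coeff_def)
  finally show ?thesis .
qed

lemma fourier_coeff_1: "fourier_coeff (\<lambda>_. 1) k = (if k = 0 then 1 else 0)"
proof -
  have "fourier_coeff (\<lambda>_. 1) k = cnj (LINT y|torus_measure. character k y)"
    unfolding fourier_coeff_def by simp
  then show ?thesis by (simp add: integral_character)
qed

lemma integrable_torus_const: "integrable (torus_measure :: (real^'n) measure) (\<lambda>_. c :: 'b :: {banach, second_countable_topology})"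
  using finite_measure.integrable_const[OF finite_measure_torus] .

lemma norm_scale_vec: "norm (c *s x) = cmod c * norm x" for x :: "complex^'d"
  by (simp add: norm_vec_def L2_set_right_distrib norm_mult)

lemma norm_trig_le: "norm (trig u K y) \<le> (\<Sum>k\<in>K. norm (u k))"
  unfolding trig_def by (rule order_trans[OF norm_sum]) (simp add: norm_scale_vec)

lemma integrable_norm_trig: "integrable torus_measure (\<lambda>y. (norm (trig u K y))\<^sup>2)"
  by (rule integrable_torus_bounded[where B="(\<Sum>k\<in>K. norm (u k))\<^sup>2"])
    (auto intro: power_mono norm_trig_le)

text \<open>Parseval's identity for finite sums, from the constant weight 1, whose Fourier matrix is
  the identity.\<close>

lemma integral_norm_trig:
  assumes "finite K"
  shows "(LINT y|torus_measure. (norm (trig u K y))\<^sup>2) = (\<Sum>k\<in>K. (norm (u k))\<^sup>2)"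
proof -
  have "complex_of_real (LINT y|torus_measure. (norm (trig u K y))\<^sup>2)
      = (LINT y|torus_measure. 1 * herm (trig u K y) (trig u K y))"
    by (simp add: herm_self flip: of_real_power)
  also have "\<dots> = (\<Sum>k\<in>K. \<Sum>l\<in>K. (if k = l then herm (u l) (u k) else 0))"
    by (subst integral_herm_trig[OF integrable_torus_const]) (auto simp: fourier_coeff_1 intro!: sum.cong)
  also have "\<dots> = complex_of_real (\<Sum>k\<in>K. (norm (u k))\<^sup>2)"
    using assms by (simp add: herm_self)
  finally show ?thesis by (simp only: of_real_eq_iff)
qed

lemma trig_L2: "trig u K \<in> L2_torus"
  by (simp add: L2_torus_def integrable_norm_trig)

lemma trig_diff:
  assumes "finite K" "finite L"
  shows "trig u K y - trig u L y
    = trig (\<lambda>k. (if k \<in> K then u k else 0) - (if k \<in> L then u k else 0)) (K \<union> L) y"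
proof -
  have "trig u K y = trig (\<lambda>k. if k \<in> K then u k else 0) (K \<union> L) y"
    unfolding trig_def using assms by (intro sum.mono_neutral_cong_left) auto
  moreover have "trig u L y = trig (\<lambda>k. if k \<in> L then u k else 0) (K \<union> L) y"
    unfolding trig_def using assms by (intro sum.mono_neutral_cong_left) auto
  ultimately show ?thesis by (simp add: trig_def sum_subtractf vec.scale_right_diff_distrib)
qed

text \<open>Common frequencies cancel, so Parseval sees only the symmetric difference. This is the
  Cauchy estimate for partial sums.\<close>

lemma integral_norm_trig_diff:
  assumes "finite K" "finite L"
  shows "(LINT y|torus_measure. (norm (trig u K y - trig u L y))\<^sup>2)
    = (\<Sum>k\<in>(K \<union> L) - (K \<inter> L). (norm (u k))\<^sup>2)"
  unfolding trig_diff[OF assms]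
  by (subst integral_norm_trig) (use assms in \<open>auto intro!: sum.mono_neutral_cong_right split: if_splits\<close>)

section \<open>Cauchy-Schwarz estimates in L^2\<close>

definition L2_norm :: "(real ^ 'n \<Rightarrow> complex ^ 'd) \<Rightarrow> real" where
  "L2_norm f = sqrt (LINT y|torus_measure. (norm (f y))\<^sup>2)"

lemma L2_norm_trig:
  assumes "finite K" shows "L2_norm (trig u K) = L2_set (\<lambda>k. norm (u k)) K"
  by (simp add: L2_norm_def L2_set_def integral_norm_trig[OF assms])

text \<open>Integrability of the product comes first, from the pointwise bound by the sum of the
  squares: it identifies the Bochner integrals with nonnegative integrals, for which Cauchy-Schwarz
  is then invoked.\<close>

lemma integral_mult_le_sqrt:
  fixes f g :: "'a \<Rightarrow> real"
  assumes [measurable]: "f \<in> borel_measurable M" "g \<in> borel_measurable M"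
    and f: "integrable M (\<lambda>x. (f x)\<^sup>2)" and g: "integrable M (\<lambda>x. (g x)\<^sup>2)"
    and pos: "\<And>x. 0 \<le> f x" "\<And>x. 0 \<le> g x"
  shows "integrable M (\<lambda>x. f x * g x)"
    and "(LINT x|M. f x * g x) \<le> sqrt (LINT x|M. (f x)\<^sup>2) * sqrt (LINT x|M. (g x)\<^sup>2)"
proof -
  have "f x * g x \<le> (f x)\<^sup>2 + (g x)\<^sup>2" for x
    using sum_squares_bound[of "f x" "g x"] pos[of x] mult_nonneg_nonneg[of "f x" "g x"] by linarith
  then show int: "integrable M (\<lambda>x. f x * g x)"
    using pos by (intro Bochner_Integration.integrable_bound[OF Bochner_Integration.integrable_add[OF f g]]) auto
  have "(\<integral>\<^sup>+x. ennreal (f x) * ennreal (g x) \<partial>M)\<^sup>2 \<le> (\<integral>\<^sup>+x. (ennreal (f x))\<^sup>2 \<partial>M) * (\<integral>\<^sup>+x. (ennreal (g x))\<^sup>2 \<partial>M)"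
    by (rule Cauchy_Schwarz_nn_integral) auto
  also have "(\<integral>\<^sup>+x. ennreal (f x) * ennreal (g x) \<partial>M) = ennreal (LINT x|M. f x * g x)"
    using pos by (subst nn_integral_eq_integral[OF int, symmetric]) (auto simp: ennreal_mult)
  also have "(\<integral>\<^sup>+x. (ennreal (f x))\<^sup>2 \<partial>M) = ennreal (LINT x|M. (f x)\<^sup>2)"
    using pos by (subst nn_integral_eq_integral[OF f, symmetric]) (auto simp: ennreal_power)
  also have "(\<integral>\<^sup>+x. (ennreal (g x))\<^sup>2 \<partial>M) = ennreal (LINT x|M. (g x)\<^sup>2)"
    using pos by (subst nn_integral_eq_integral[OF g, symmetric]) (auto simp: ennreal_power)
  finally have "(LINT x|M. f x * g x)\<^sup>2 \<le> (LINT x|M. (f x)\<^sup>2) * (LINT x|M. (g x)\<^sup>2)"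
    using pos by (simp add: ennreal_power ennreal_mult[symmetric])
  then show "(LINT x|M. f x * g x) \<le> sqrt (LINT x|M. (f x)\<^sup>2) * sqrt (LINT x|M. (g x)\<^sup>2)"
    by (simp add: real_sqrt_mult[symmetric] real_le_rsqrt)
qed

lemma weighted_herm_bound:
  fixes f h :: "real^'n \<Rightarrow> complex^'d" and B :: "real^'n \<Rightarrow> complex"
  assumes [measurable]: "B \<in> borel_measurable torus_measure" and B: "\<And>y. cmod (B y) \<le> b"
    and f: "f \<in> L2_torus" and h: "h \<in> L2_torus"
  shows "integrable torus_measure (\<lambda>y. B y * herm (f y) (h y))"
    and "cmod (LINT y|torus_measure. B y * herm (f y) (h y)) \<le> b * (L2_norm f * L2_norm h)"
proof -
  have [measurable]: "f \<in> borel_measurable torus_measure" "h \<in> borel_measurable torus_measure"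
    and f2: "integrable torus_measure (\<lambda>y. (norm (f y))\<^sup>2)" and h2: "integrable torus_measure (\<lambda>y. (norm (h y))\<^sup>2)"
    using f h by (auto simp: L2_torus_def)
  have b: "b \<ge> 0" using B[of undefined] norm_ge_zero order_trans by blast
  note cs = integral_mult_le_sqrt[of "\<lambda>y. norm (f y)" torus_measure "\<lambda>y. norm (h y)", OF _ _ f2 h2]
  have i1: "integrable torus_measure (\<lambda>y. norm (f y) * norm (h y))" by (rule cs(1)) auto
  have pt: "cmod (B y * herm (f y) (h y)) \<le> b * (norm (f y) * norm (h y))" for y
    unfolding norm_mult using B b by (intro mult_mono norm_herm_le) auto
  show int: "integrable torus_measure (\<lambda>y. B y * herm (f y) (h y))"
    by (rule Bochner_Integration.integrable_bound[OF integrable_mult_right[OF i1, of b]])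
      (use pt b in \<open>auto simp: abs_mult\<close>)
  have "cmod (LINT y|torus_measure. B y * herm (f y) (h y)) \<le> (LINT y|torus_measure. b * (norm (f y) * norm (h y)))"
    by (rule Bochner_Integration.integral_norm_bound_integral[OF int integrable_mult_right[OF i1] pt])
  also have "\<dots> \<le> b * (L2_norm f * L2_norm h)"
    unfolding L2_norm_def integral_mult_right_zero using b by (intro mult_left_mono cs(2)) auto
  finally show "cmod (LINT y|torus_measure. B y * herm (f y) (h y)) \<le> b * (L2_norm f * L2_norm h)" .
qed

lemma L2_torus_diff:
  fixes f h :: "real^'n \<Rightarrow> complex^'d"
  assumes "f \<in> L2_torus" "h \<in> L2_torus"
  shows "(\<lambda>y. f y - h y) \<in> L2_torus"
proof -
  have [measurable]: "f \<in> borel_measurable torus_measure" "h \<in> borel_measurable torus_measure"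
    and i: "integrable torus_measure (\<lambda>y. 2 * (norm (f y))\<^sup>2 + 2 * (norm (h y))\<^sup>2)"
    using assms by (auto simp: L2_torus_def)
  have "(norm (f y - h y))\<^sup>2 \<le> 2 * (norm (f y))\<^sup>2 + 2 * (norm (h y))\<^sup>2" for y
  proof -
    have "(norm (f y - h y))\<^sup>2 \<le> (norm (f y) + norm (h y))\<^sup>2"
      by (intro power_mono norm_triangle_ineq4) simp
    also have "\<dots> \<le> 2 * (norm (f y))\<^sup>2 + 2 * (norm (h y))\<^sup>2"
      using sum_squares_bound[of "norm (f y)" "norm (h y)"] by (simp add: power2_sum)
    finally show ?thesis .
  qed
  then have "integrable torus_measure (\<lambda>y. (norm (f y - h y))\<^sup>2)"
    by (intro Bochner_Integration.integrable_bound[OF i]) auto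
  then show ?thesis by (simp add: L2_torus_def)
qed

text \<open>Continuity of the weighted pairing under L^2 convergence of both arguments. It carries
  identities for trigonometric polynomials over to \<open>P_grad\<close>.\<close>

lemma tendsto_weighted_herm:
  fixes f h :: "real^'n \<Rightarrow> complex^'d" and B :: "real^'n \<Rightarrow> complex"
  assumes B: "B \<in> borel_measurable torus_measure" "\<And>y. cmod (B y) \<le> b"
    and L2: "f \<in> L2_torus" "h \<in> L2_torus" "\<And>i. u i \<in> L2_torus" "\<And>i. v i \<in> L2_torus"
    and lim: "((\<lambda>i. L2_norm (\<lambda>y. f y - u i y)) \<longlongrightarrow> 0) F" "((\<lambda>i. L2_norm (\<lambda>y. h y - v i y)) \<longlongrightarrow> 0) F"
  shows "((\<lambda>i. LINT y|torus_measure. B y * herm (u i y) (v i y))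
    \<longlongrightarrow> (LINT y|torus_measure. B y * herm (f y) (h y))) F"
proof -
  let ?a = "\<lambda>i. L2_norm (\<lambda>y. f y - u i y)" and ?c = "\<lambda>i. L2_norm (\<lambda>y. h y - v i y)"
  let ?I = "\<lambda>f h. LINT y|torus_measure. B y * herm (f y) (h y)"
  note bd = weighted_herm_bound[OF B]
  have est: "norm (?I (u i) (v i) - ?I f h) \<le> b * (L2_norm f * ?c i + ?a i * L2_norm h + ?a i * ?c i)" for i
  proof -
    let ?f = "\<lambda>y. f y - u i y" and ?h = "\<lambda>y. h y - v i y"
    have d: "?f \<in> L2_torus" "?h \<in> L2_torus" using L2 by (auto intro: L2_torus_diff)
    \<comment> \<open>Sesquilinear expansion after writing \<open>u i\<close> as \<open>f\<close>
      minus its error and \<open>v i\<close> as \<open>h\<close> minus its error; each remaining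
      term contains an error factor that tends to 0.\<close>
    have "?I (u i) (v i) = (LINT y|torus_measure. B y * herm (f y) (h y) - B y * herm (f y) (?h y)
        - B y * herm (?f y) (h y) + B y * herm (?f y) (?h y))"
      by (intro Bochner_Integration.integral_cong) (auto simp: herm_diff_left herm_diff_right algebra_simps)
    also have "\<dots> = ?I f h - ?I f ?h - ?I ?f h + ?I ?f ?h"
      using bd(1)[OF L2(1,2)] bd(1)[OF L2(1) d(2)] bd(1)[OF d(1) L2(2)] bd(1)[OF d] by simp
    finally have e: "?I (u i) (v i) = ?I f h - ?I f ?h - ?I ?f h + ?I ?f ?h" .
    have "norm (?I (u i) (v i) - ?I f h) = norm (- ?I f ?h - ?I ?f h + ?I ?f ?h)"
      unfolding e by (simp add: algebra_simps)
    also have "\<dots> \<le> norm (?I f ?h) + norm (?I ?f h) + norm (?I ?f ?h)"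
      by (smt (verit) norm_minus_cancel norm_triangle_ineq norm_triangle_ineq4)
    also have "\<dots> \<le> b * (L2_norm f * ?c i) + b * (?a i * L2_norm h) + b * (?a i * ?c i)"
      by (intro add_mono bd(2) L2 d)
    finally show ?thesis by (simp add: distrib_left)
  qed
  have "((\<lambda>i. b * (L2_norm f * ?c i + ?a i * L2_norm h + ?a i * ?c i)) \<longlongrightarrow> b * (L2_norm f * 0 + 0 * L2_norm h + 0 * 0)) F"
    by (intro tendsto_intros lim)
  then have "((\<lambda>i. ?I (u i) (v i) - ?I f h) \<longlongrightarrow> 0) F"
    by (intro Lim_null_comparison[OF always_eventually[OF allI[OF est]]]) simp
  then show ?thesis by (rule LIM_zero_cancel)
qed

section \<open>The Riesz-Fischer theorem\<close>

text \<open>The sum over \<open>F\<close> is within \<open>e\<close> of the total, and by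
  nonnegativity a finite \<open>K\<close> outside \<open>F\<close> can only fill part of the
  remaining gap.\<close>

lemma summable_on_small_tail:
  fixes a :: "'a \<Rightarrow> real"
  assumes a: "a summable_on I" and pos: "\<And>k. 0 \<le> a k" and e: "e > 0"
  obtains F where "finite F" "F \<subseteq> I" "\<And>K. finite K \<Longrightarrow> K \<subseteq> I - F \<Longrightarrow> sum a K \<le> e"
proof -
  from has_sum_infsum[OF a] obtain F where F: "finite F" "F \<subseteq> I" "dist (sum a F) (infsum a I) \<le> e"
    using has_sum_finite_approximation[OF _ e] by metis
  have "sum a K \<le> e" if K: "finite K" "K \<subseteq> I - F" for K
  proof -
    have "sum a (F \<union> K) \<le> infsum a I"
      using a F K pos by (intro finite_sum_le_infsum) auto
    also have "sum a (F \<union> K) = sum a F + sum a K"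
      using F K by (intro sum.union_disjoint) auto
    finally show ?thesis using F(3) by (simp add: dist_real_def)
  qed
  then show ?thesis using that F by blast
qed

text \<open>Partial sums along growing sets are Cauchy in L^2, hence in L^1, so a subsequence
  converges almost everywhere. Fatou's lemma carries the Cauchy estimate to the limit
  \<open>g\<close> for every finite \<open>K\<close> containing \<open>F m\<close>, which gives
  convergence along all finite subsets and not only along the subsequence.\<close>

lemma riesz_fischer:
  fixes c :: "int^'n \<Rightarrow> complex^'d"
  assumes c: "(\<lambda>k. (norm (c k))\<^sup>2) summable_on I"
  obtains g where "g \<in> L2_torus"
    "((\<lambda>K. LINT y|torus_measure. (norm (g y - trig c K y))\<^sup>2) \<longlongrightarrow> 0) (finite_subsets_at_top I)"
proof -
  define a where "a k = (norm (c k))\<^sup>2" for k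
  have a0: "a k \<ge> 0" for k by (simp add: a_def)
  have "\<exists>F. finite F \<and> F \<subseteq> I \<and> (\<forall>K. finite K \<longrightarrow> K \<subseteq> I - F \<longrightarrow> sum a K \<le> (1/4) ^ m)" for m :: nat
    using summable_on_small_tail[OF c[folded a_def] a0, of "(1/4) ^ m"] by (metis zero_less_divide_1_iff zero_less_numeral zero_less_power)
  then obtain F where F: "\<And>m. finite (F m)" "\<And>m. F m \<subseteq> I"
    "\<And>m K. finite K \<Longrightarrow> K \<subseteq> I - F m \<Longrightarrow> sum a K \<le> (1/4) ^ m" by metis
  \<comment> \<open>The unions are nested, so any two \<open>T i\<close>, \<open>T j\<close> with
    \<open>i, j \<ge> n\<close> contain \<open>F n\<close> and fall under
    \<open>close\<close>.\<close>
  define T where "T m = (\<Union>i\<le>m. F i)" for m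
  have T: "finite (T m)" "T m \<subseteq> I" "j \<le> m \<Longrightarrow> F j \<subseteq> T m" for j m
    using F by (auto simp: T_def)
  have close: "(LINT y|torus_measure. (norm (trig c K y - trig c L y))\<^sup>2) \<le> (1/4) ^ m"
    if "finite K" "finite L" "K \<subseteq> I" "L \<subseteq> I" "F m \<subseteq> K" "F m \<subseteq> L" for K L m
    unfolding integral_norm_trig_diff[OF that(1,2)] a_def[symmetric]
    using that by (intro F(3)) auto
  have integrable_diff: "integrable torus_measure (\<lambda>y. (norm (trig c K y - trig c L y))\<^sup>2)" for K L
    using L2_torus_diff[OF trig_L2 trig_L2, of c K c L] by (simp add: L2_torus_def)
  have small: "\<exists>n. (1/4::real) ^ n < e" if "e > 0" for e
    using that by (intro real_arch_pow_inv) auto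

  obtain r where r: "strict_mono r" and Cau: "AE y in torus_measure. Cauchy (\<lambda>i. trig c (T (r i)) y)"
  proof (rule cauchy_L1_AE_cauchy_subseq[of torus_measure "\<lambda>m. trig c (T m)"])
    show "integrable torus_measure (trig c (T m))" for m
      by (rule integrable_torus_bounded[OF borel_measurable_trig norm_trig_le])
    fix e :: real assume "e > 0"
    then obtain n where n: "(1/4::real) ^ n < e\<^sup>2" using small[of "e\<^sup>2"] by auto
    have "(LINT y|torus_measure. norm (trig c (T i) y - trig c (T j) y)) < e" if "i \<ge> n" "j \<ge> n" for i j
    proof -
      \<comment> \<open>The factor 1 prepares Cauchy-Schwarz: on a probability space the L^1 norm is
        at most the L^2 norm.\<close>
      have "(LINT y|torus_measure. norm (trig c (T i) y - trig c (T j) y) * 1)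
          \<le> sqrt (LINT y|torus_measure. (norm (trig c (T i) y - trig c (T j) y))\<^sup>2) * sqrt (LINT y|(torus_measure::(real^'n) measure). 1\<^sup>2)"
        by (rule integral_mult_le_sqrt(2)) (auto intro: integrable_diff integrable_torus_const)
      also have "\<dots> \<le> sqrt ((1/4) ^ n)"
        using T that by (simp del: power_one_over) (intro close; force)
      also have "\<dots> < e" using n \<open>e > 0\<close> by (simp add: real_less_lsqrt)
      finally show ?thesis by simp
    qed
    then show "\<exists>N. \<forall>i\<ge>N. \<forall>j\<ge>N. (LINT y|torus_measure. norm (trig c (T i) y - trig c (T j) y)) < e" by blast
  qed
  \<comment> \<open>Where the subsequence diverges \<open>lim\<close> is an unspecified value; this
    happens only on a null set.\<close>
  define g where "g y = lim (\<lambda>i. trig c (T (r i)) y)" for y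
  have g_meas [measurable]: "g \<in> borel_measurable torus_measure"
    unfolding g_def by (rule borel_measurable_lim_metric) simp
  have g_lim: "AE y in torus_measure. (\<lambda>i. trig c (T (r i)) y) \<longlonglongrightarrow> g y"
    using Cau by eventually_elim (simp add: g_def Cauchy_convergent_iff convergent_LIMSEQ_iff)
  have g_close: "integrable torus_measure (\<lambda>y. (norm (g y - trig c K y))\<^sup>2) \<and>
      (LINT y|torus_measure. (norm (g y - trig c K y))\<^sup>2) \<le> (1/4) ^ m"
    if K: "finite K" "K \<subseteq> I" "F m \<subseteq> K" for K m
  proof -
    let ?u = "\<lambda>i y. ennreal ((norm (trig c (T (r i)) y - trig c K y))\<^sup>2)"
    have "(\<integral>\<^sup>+y. ennreal ((norm (g y - trig c K y))\<^sup>2) \<partial>torus_measure) = (\<integral>\<^sup>+y. liminf (\<lambda>i. ?u i y) \<partial>torus_measure)"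
    proof (rule nn_integral_cong_AE)
      show "AE y in torus_measure. ennreal ((norm (g y - trig c K y))\<^sup>2) = liminf (\<lambda>i. ?u i y)"
        using g_lim
      proof eventually_elim
        case (elim y)
        have "(\<lambda>i. ?u i y) \<longlonglongrightarrow> ennreal ((norm (g y - trig c K y))\<^sup>2)"
          by (intro tendsto_intros elim)
        from lim_imp_Liminf[OF _ this] show ?case by simp
      qed
    qed
    \<comment> \<open>Fatou's lemma.\<close>
    also have "\<dots> \<le> liminf (\<lambda>i. \<integral>\<^sup>+y. ?u i y \<partial>torus_measure)"
      by (rule nn_integral_liminf) measurable
    also have "\<dots> \<le> ennreal ((1/4) ^ m)"
    proof (rule Liminf_le)
      show "\<forall>\<^sub>F i in sequentially. (\<integral>\<^sup>+y. ?u i y \<partial>torus_measure) \<le> ennreal ((1/4) ^ m)"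
      proof (rule eventually_sequentiallyI)
        fix i assume "m \<le> i"
        then have "m \<le> r i" using seq_suble[OF r, of i] by simp
        then have "F m \<subseteq> T (r i)" by (rule T(3))
        then show "(\<integral>\<^sup>+y. ?u i y \<partial>torus_measure) \<le> ennreal ((1/4) ^ m)"
          by (subst nn_integral_eq_integral[OF integrable_diff])
            (use close[OF T(1) K(1) T(2) K(2) _ K(3)] in \<open>auto intro!: ennreal_leI\<close>)
      qed
    qed simp
    finally have le: "(\<integral>\<^sup>+y. ennreal ((norm (g y - trig c K y))\<^sup>2) \<partial>torus_measure) \<le> ennreal ((1/4) ^ m)" .
    have int: "integrable torus_measure (\<lambda>y. (norm (g y - trig c K y))\<^sup>2)"
      by (rule integrableI_bounded) (use le in \<open>auto intro: le_less_trans\<close>)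
    moreover have "(LINT y|torus_measure. (norm (g y - trig c K y))\<^sup>2) \<le> (1/4) ^ m"
      using le by (subst (asm) nn_integral_eq_integral[OF int]) (auto simp: ennreal_le_iff)
    ultimately show ?thesis by blast
  qed
  \<comment> \<open>The difference of these two functions is \<open>g\<close>, so closure of
    \<open>L2_torus\<close> under differences suffices.\<close>
  have "(\<lambda>y. g y - trig c (F 0) y) \<in> L2_torus" "(\<lambda>y. - trig c (F 0) y) \<in> L2_torus"
    using g_close[of "F 0" 0] F integrable_norm_trig[of c "F 0"] by (auto simp: L2_torus_def)
  from L2_torus_diff[OF this] have g_L2: "g \<in> L2_torus" by simp
  have "((\<lambda>K. LINT y|torus_measure. (norm (g y - trig c K y))\<^sup>2) \<longlongrightarrow> 0) (finite_subsets_at_top I)"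
  proof (rule tendstoI)
    fix e :: real assume "e > 0"
    then obtain m where m: "(1/4::real) ^ m < e" using small by blast
    have "\<forall>\<^sub>F K in finite_subsets_at_top I. finite K \<and> F m \<subseteq> K \<and> K \<subseteq> I"
      unfolding eventually_finite_subsets_at_top using F by (intro exI[of _ "F m"]) auto
    then show "\<forall>\<^sub>F K in finite_subsets_at_top I. dist (LINT y|torus_measure. (norm (g y - trig c K y))\<^sup>2) 0 < e"
    proof eventually_elim
      case (elim K)
      then have "(LINT y|torus_measure. (norm (g y - trig c K y))\<^sup>2) \<le> (1/4) ^ m"
        using g_close by blast
      then show ?case using m by simp
    qed
  qed
  with g_L2 show ?thesis by (rule that)
qed

section \<open>Matrices on square summable sequences\<close>

text \<open>The l^2 norm of \<open>x\<close> over \<open>I\<close> is at most \<open>B\<close>,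
  expressed by finite sections so that no convergence has to be settled beforehand.\<close>

definition l2_le :: "'a set \<Rightarrow> ('a \<Rightarrow> complex) \<Rightarrow> real \<Rightarrow> bool" where
  "l2_le I x B \<longleftrightarrow> (\<forall>K. finite K \<longrightarrow> K \<subseteq> I \<longrightarrow> L2_set (\<lambda>k. cmod (x k)) K \<le> B)"

text \<open>An operator norm bound on l^2 tested on finite rectangular sections. Rows
  \<open>K\<close> and columns \<open>L\<close> vary independently, so \<open>L\<close> can later
  exhaust \<open>I\<close> while \<open>K\<close> stays fixed.\<close>

definition sections_le :: "'a set \<Rightarrow> ('a \<Rightarrow> 'a \<Rightarrow> complex) \<Rightarrow> real \<Rightarrow> bool" where
  "sections_le I R q \<longleftrightarrow> (\<forall>K L x. finite K \<longrightarrow> K \<subseteq> I \<longrightarrow> finite L \<longrightarrow> L \<subseteq> I \<longrightarrow>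
     L2_set (\<lambda>k. cmod (\<Sum>l\<in>L. R k l * x l)) K \<le> q * L2_set (\<lambda>l. cmod (x l)) L)"

lemma l2_le_nonneg: "l2_le I x B \<Longrightarrow> 0 \<le> B"
  unfolding l2_le_def by (metis L2_set_empty empty_subsetI finite.emptyI)

lemma l2_le_point:
  assumes "l2_le I x B" "k \<in> I"
  shows "cmod (x k) \<le> B"
  using assms unfolding l2_le_def by (auto dest!: spec[of _ "{k}"])

lemma l2_le_iff_summable:
  "(\<exists>B. l2_le I x B) \<longleftrightarrow> (\<lambda>k. (cmod (x k))\<^sup>2) summable_on I"
proof
  assume "\<exists>B. l2_le I x B"
  then obtain B where B: "l2_le I x B" ..
  show "(\<lambda>k. (cmod (x k))\<^sup>2) summable_on I"
  proof (rule nonneg_bdd_above_summable_on)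
    show "bdd_above (sum (\<lambda>k. (cmod (x k))\<^sup>2) ` {F. F \<subseteq> I \<and> finite F})"
    proof (rule bdd_aboveI2)
      fix F assume F: "F \<in> {F. F \<subseteq> I \<and> finite F}"
      then have "sqrt (\<Sum>k\<in>F. (cmod (x k))\<^sup>2) \<le> B"
        using B by (auto simp: l2_le_def L2_set_def)
      then have "sqrt (\<Sum>k\<in>F. (cmod (x k))\<^sup>2) ^ 2 \<le> B ^ 2"
        by (intro power_mono) (auto intro: sum_nonneg)
      then show "(\<Sum>k\<in>F. (cmod (x k))\<^sup>2) \<le> B\<^sup>2" by (simp add: sum_nonneg)
    qed
  qed simp
next
  assume s: "(\<lambda>k. (cmod (x k))\<^sup>2) summable_on I"
  have "l2_le I x (sqrt (\<Sum>\<^sub>\<infinity>k\<in>I. (cmod (x k))\<^sup>2))"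
    unfolding l2_le_def L2_set_def
    by (auto intro!: finite_sum_le_infsum s)
  then show "\<exists>B. l2_le I x B" ..
qed

lemma sections_le_add:
  assumes "sections_le I R q" "sections_le I R' q'"
  shows "sections_le I (\<lambda>k l. R k l + R' k l) (q + q')"
  unfolding sections_le_def
proof (intro allI impI)
  fix K L x assume KL: "finite K" "K \<subseteq> I" "finite L" "L \<subseteq> I"
  have "L2_set (\<lambda>k. cmod (\<Sum>l\<in>L. (R k l + R' k l) * x l)) K
      \<le> L2_set (\<lambda>k. cmod (\<Sum>l\<in>L. R k l * x l) + cmod (\<Sum>l\<in>L. R' k l * x l)) K"
    by (intro L2_set_mono) (auto simp: distrib_right sum.distrib intro: norm_triangle_ineq)
  also have "\<dots> \<le> L2_set (\<lambda>k. cmod (\<Sum>l\<in>L. R k l * x l)) K + L2_set (\<lambda>k. cmod (\<Sum>l\<in>L. R' k l * x l)) K"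
    by (rule L2_set_triangle_ineq)
  also have "\<dots> \<le> q * L2_set (\<lambda>l. cmod (x l)) L + q' * L2_set (\<lambda>l. cmod (x l)) L"
    using assms KL unfolding sections_le_def by (intro add_mono) auto
  finally show "L2_set (\<lambda>k. cmod (\<Sum>l\<in>L. (R k l + R' k l) * x l)) K \<le> (q + q') * L2_set (\<lambda>l. cmod (x l)) L"
    by (simp add: distrib_right)
qed

section \<open>Matrices dominated by a convolution\<close>

lemma has_sum_shift:
  fixes m :: "'a :: ab_group_add \<Rightarrow> real"
  assumes "m summable_on UNIV"
  shows "((\<lambda>l. m (k - l)) has_sum infsum m UNIV) UNIV" "((\<lambda>l. m (l - k)) has_sum infsum m UNIV) UNIV"
proof -
  have b: "bij_betw (\<lambda>l. k - l) UNIV UNIV" "bij_betw (\<lambda>l. l - k) UNIV UNIV"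
    by (rule bij_betwI[of _ _ _ "\<lambda>l. k - l"], auto) (rule bij_betwI[of _ _ _ "\<lambda>l. l + k"], auto)
  show "((\<lambda>l. m (k - l)) has_sum infsum m UNIV) UNIV" "((\<lambda>l. m (l - k)) has_sum infsum m UNIV) UNIV"
    using has_sum_reindex_bij_betw[OF b(1), of m] has_sum_reindex_bij_betw[OF b(2), of m] assms by auto
qed

text \<open>Schur's test: by translation invariance every row sum and every column sum of the
  majorant is at most the total sum of \<open>m\<close>.\<close>

lemma schur_test_convolution:
  fixes m :: "'a :: ab_group_add \<Rightarrow> real"
  assumes R: "\<And>k l. k \<in> I \<Longrightarrow> l \<in> I \<Longrightarrow> cmod (R k l) \<le> m (k - l)"
    and m: "m summable_on UNIV" and pos: "\<And>j. 0 \<le> m j"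
  shows "sections_le I R (infsum m UNIV)"
  unfolding sections_le_def
proof (intro allI impI)
  fix K L x assume KL: "finite K" "K \<subseteq> I" "finite L" "L \<subseteq> I"
  define S where "S = infsum m UNIV"
  have S: "S \<ge> 0" unfolding S_def by (intro infsum_nonneg pos)
  have row: "(\<Sum>l\<in>L. m (k - l)) \<le> S" for k
    using finite_sum_le_has_sum[OF has_sum_shift(1)[OF m, of k] KL(3)] pos by (simp add: S_def)
  have col: "(\<Sum>k\<in>K. m (k - l)) \<le> S" for l
    using finite_sum_le_has_sum[OF has_sum_shift(2)[OF m, of l] KL(1)] pos by (simp add: S_def)
  have pt: "(cmod (\<Sum>l\<in>L. R k l * x l))\<^sup>2 \<le> S * (\<Sum>l\<in>L. m (k - l) * (cmod (x l))\<^sup>2)" if "k \<in> K" for k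
  proof -
    \<comment> \<open>\<open>m (k - l)\<close> is split into two square roots before Cauchy-Schwarz:
      one produces the row sum, the other stays with \<open>x l\<close> for the column sum taken
      afterwards.\<close>
    have "cmod (\<Sum>l\<in>L. R k l * x l) \<le> (\<Sum>l\<in>L. \<bar>sqrt (m (k - l))\<bar> * \<bar>sqrt (m (k - l)) * cmod (x l)\<bar>)"
    proof (rule order_trans[OF norm_sum], rule sum_mono)
      fix l assume "l \<in> L"
      then show "cmod (R k l * x l) \<le> \<bar>sqrt (m (k - l))\<bar> * \<bar>sqrt (m (k - l)) * cmod (x l)\<bar>"
        using R[of k l] KL that pos by (auto simp: norm_mult abs_mult mult.assoc[symmetric] intro!: mult_right_mono)
    qed
    also have "\<dots> \<le> L2_set (\<lambda>l. sqrt (m (k - l))) L * L2_set (\<lambda>l. sqrt (m (k - l)) * cmod (x l)) L"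
      by (rule L2_set_mult_ineq)
    also have "\<dots> = sqrt ((\<Sum>l\<in>L. m (k - l)) * (\<Sum>l\<in>L. m (k - l) * (cmod (x l))\<^sup>2))"
      by (simp add: L2_set_def real_sqrt_mult power_mult_distrib pos)
    also have "\<dots> \<le> sqrt (S * (\<Sum>l\<in>L. m (k - l) * (cmod (x l))\<^sup>2))"
      by (intro real_sqrt_le_mono mult_right_mono row sum_nonneg mult_nonneg_nonneg pos) auto
    finally have "(cmod (\<Sum>l\<in>L. R k l * x l))\<^sup>2 \<le> (sqrt (S * (\<Sum>l\<in>L. m (k - l) * (cmod (x l))\<^sup>2)))\<^sup>2"
      by (intro power_mono) auto
    then show ?thesis
      by (simp add: S sum_nonneg pos)
  qed
  have "(\<Sum>k\<in>K. (cmod (\<Sum>l\<in>L. R k l * x l))\<^sup>2) \<le> (\<Sum>k\<in>K. S * (\<Sum>l\<in>L. m (k - l) * (cmod (x l))\<^sup>2))"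
    by (intro sum_mono pt)
  also have "\<dots> = S * (\<Sum>l\<in>L. (\<Sum>k\<in>K. m (k - l)) * (cmod (x l))\<^sup>2)"
    by (simp add: sum_distrib_left sum_distrib_right) (rule sum.swap)
  also have "\<dots> \<le> S * (\<Sum>l\<in>L. S * (cmod (x l))\<^sup>2)"
    by (intro mult_left_mono sum_mono mult_right_mono col S) auto
  also have "\<dots> = S\<^sup>2 * (\<Sum>l\<in>L. (cmod (x l))\<^sup>2)"
    by (simp add: sum_distrib_left power2_eq_square mult.assoc)
  finally have "sqrt (\<Sum>k\<in>K. (cmod (\<Sum>l\<in>L. R k l * x l))\<^sup>2) \<le> sqrt (S\<^sup>2 * (\<Sum>l\<in>L. (cmod (x l))\<^sup>2))"
    by (rule real_sqrt_le_mono)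
  then show "L2_set (\<lambda>k. cmod (\<Sum>l\<in>L. R k l * x l)) K \<le> infsum m UNIV * L2_set (\<lambda>l. cmod (x l)) L"
    using S by (simp add: L2_set_def real_sqrt_mult S_def)
qed

text \<open>The product of the moduli of \<open>x l\<close> and \<open>y k\<close> is at most the
  sum of their squares, and against \<open>m (k - l)\<close> each square can be summed in the other
  index first. Absolute convergence permits rearranging the double sum.\<close>

lemma convolution_pairing_summable:
  fixes m :: "'a :: ab_group_add \<Rightarrow> real"
  assumes R: "\<And>k l. k \<in> I \<Longrightarrow> l \<in> I \<Longrightarrow> cmod (R k l) \<le> m (k - l)"
    and m: "m summable_on UNIV" and pos: "\<And>j. 0 \<le> m j"
    and x: "(\<lambda>k. (cmod (x k))\<^sup>2) summable_on I" and y: "(\<lambda>k. (cmod (y k))\<^sup>2) summable_on I"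
  shows "(\<lambda>(k, l). cmod (R k l * x l * cnj (y k))) summable_on (I \<times> I)"
proof -
  have "(\<lambda>(k, l). m (k - l) * (cmod (y k))\<^sup>2) summable_on (I \<times> UNIV)"
    by (rule summable_on_SigmaI[where g="\<lambda>k. infsum m UNIV * (cmod (y k))\<^sup>2"])
      (auto intro!: has_sum_cmult_left has_sum_shift m summable_on_cmult_right y pos mult_nonneg_nonneg)
  then have 1: "(\<lambda>(k, l). m (k - l) * (cmod (y k))\<^sup>2) summable_on (I \<times> I)"
    by (rule summable_on_subset) auto
  \<comment> \<open>The column index is placed outside so that the inner sum runs over the shifted
    \<open>m\<close>; the pairs are swapped back afterwards.\<close>
  have "(\<lambda>(l, k). m (k - l) * (cmod (x l))\<^sup>2) summable_on (I \<times> UNIV)"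
    by (rule summable_on_SigmaI[where g="\<lambda>l. infsum m UNIV * (cmod (x l))\<^sup>2"])
      (auto intro!: has_sum_cmult_left has_sum_shift m summable_on_cmult_right x pos mult_nonneg_nonneg)
  then have "(\<lambda>(l, k). m (k - l) * (cmod (x l))\<^sup>2) summable_on (I \<times> I)"
    by (rule summable_on_subset) auto
  then have 2: "(\<lambda>(k, l). m (k - l) * (cmod (x l))\<^sup>2) summable_on (I \<times> I)"
    by (subst (asm) summable_on_swap) (simp add: case_prod_unfold)
  have "(\<lambda>p. m (fst p - snd p) * (cmod (y (fst p)))\<^sup>2 + m (fst p - snd p) * (cmod (x (snd p)))\<^sup>2) summable_on (I \<times> I)"
    using summable_on_add[OF 1 2] by (simp add: case_prod_unfold)
  then show ?thesis
  proof (rule summable_on_comparison_test)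
    fix p assume "p \<in> I \<times> I"
    then obtain k l where p: "p = (k, l)" "k \<in> I" "l \<in> I" by auto
    have "cmod (x l) * cmod (y k) \<le> (cmod (y k))\<^sup>2 + (cmod (x l))\<^sup>2"
      using sum_squares_bound[of "cmod (x l)" "cmod (y k)"]
        mult_nonneg_nonneg[OF norm_ge_zero norm_ge_zero, of "x l" "y k"]
      unfolding mult.assoc by linarith
    then have "cmod (R k l) * (cmod (x l) * cmod (y k)) \<le> m (k - l) * ((cmod (y k))\<^sup>2 + (cmod (x l))\<^sup>2)"
      using R p pos by (intro mult_mono) auto
    then show "(case p of (k, l) \<Rightarrow> cmod (R k l * x l * cnj (y k)))
        \<le> m (fst p - snd p) * (cmod (y (fst p)))\<^sup>2 + m (fst p - snd p) * (cmod (x (snd p)))\<^sup>2"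
      by (simp add: p norm_mult distrib_left mult.assoc)
  qed auto
qed

section \<open>Infinite matrices and the Neumann series\<close>

lemma row_product_summable:
  assumes "(\<lambda>l. cmod (R k l)) summable_on I" "l2_le I x B"
  shows "(\<lambda>l. norm (R k l * x l)) summable_on I"
proof (rule summable_on_comparison_test[OF summable_on_cmult_left[OF assms(1), of B]])
  fix l assume "l \<in> I"
  then show "norm (R k l * x l) \<le> cmod (R k l) * B"
    using l2_le_point[OF assms(2)] by (simp add: norm_mult mult_left_mono)
qed simp

text \<open>For fixed \<open>K\<close> the section bound passes to the limit as \<open>L\<close>
  grows to \<open>I\<close>. Absolutely summable rows and bounded entries of \<open>x\<close> make
  the rowwise limits exist.\<close>

lemma l2_le_apply:
  assumes R: "sections_le I R q" "q \<ge> 0" and rows: "\<And>k. k \<in> I \<Longrightarrow> (\<lambda>l. cmod (R k l)) summable_on I"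
    and x: "l2_le I x B"
  shows "l2_le I (\<lambda>k. \<Sum>\<^sub>\<infinity>l\<in>I. R k l * x l) (q * B)"
  unfolding l2_le_def
proof (intro allI impI)
  fix K assume K: "finite K" "K \<subseteq> I"
  have lim: "((\<lambda>L. \<Sum>l\<in>L. R k l * x l) \<longlongrightarrow> (\<Sum>\<^sub>\<infinity>l\<in>I. R k l * x l)) (finite_subsets_at_top I)" if "k \<in> K" for k
  proof -
    have "k \<in> I" using K that by blast
    from abs_summable_summable[OF row_product_summable[of R, OF rows[OF this] x]] show ?thesis
      by (rule infsum_tendsto)
  qed
  have "((\<lambda>L. L2_set (\<lambda>k. cmod (\<Sum>l\<in>L. R k l * x l)) K)
      \<longlongrightarrow> L2_set (\<lambda>k. cmod (\<Sum>\<^sub>\<infinity>l\<in>I. R k l * x l)) K) (finite_subsets_at_top I)"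
    unfolding L2_set_def by (intro tendsto_real_sqrt tendsto_sum tendsto_power tendsto_norm lim)
  then show "L2_set (\<lambda>k. cmod (\<Sum>\<^sub>\<infinity>l\<in>I. R k l * x l)) K \<le> q * B"
  proof (rule tendsto_upperbound)
    show "\<forall>\<^sub>F L in finite_subsets_at_top I. L2_set (\<lambda>k. cmod (\<Sum>l\<in>L. R k l * x l)) K \<le> q * B"
    proof (rule eventually_finite_subsets_at_top_weakI)
      fix L assume L: "finite L" "L \<subseteq> I"
      have "L2_set (\<lambda>k. cmod (\<Sum>l\<in>L. R k l * x l)) K \<le> q * L2_set (\<lambda>l. cmod (x l)) L"
        using R K L by (auto simp: sections_le_def)
      also have "\<dots> \<le> q * B" using x L R by (intro mult_left_mono) (auto simp: l2_le_def)
      finally show "L2_set (\<lambda>k. cmod (\<Sum>l\<in>L. R k l * x l)) K \<le> q * B" .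
    qed
  qed simp
qed

text \<open>The iterates \<open>d m\<close> of \<open>b\<close> under the matrix decay like
  \<open>q ^ m * B\<close>, so their entrywise sum \<open>x\<close> exists and inherits the
  geometric bound. The fixed point equation follows by exchanging the sums over \<open>m\<close> and
  \<open>l\<close>.\<close>

lemma neumann_series:
  assumes R: "sections_le I R q" "0 \<le> q" "q < 1"
    and rows: "\<And>k. k \<in> I \<Longrightarrow> (\<lambda>l. cmod (R k l)) summable_on I"
    and b: "l2_le I b B"
  obtains x where "l2_le I x (B / (1 - q))" "\<And>k. k \<in> I \<Longrightarrow> x k = b k + (\<Sum>\<^sub>\<infinity>l\<in>I. R k l * x l)"
proof -
  define d where "d m = ((\<lambda>x k. \<Sum>\<^sub>\<infinity>l\<in>I. R k l * x l) ^^ m) b" for m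
  have d_Suc: "d (Suc m) k = (\<Sum>\<^sub>\<infinity>l\<in>I. R k l * d m l)" for m k by (simp add: d_def)
  have d: "l2_le I (d m) (q ^ m * B)" for m
  proof (induction m)
    case (Suc m)
    from l2_le_apply[OF R(1,2) rows Suc] show ?case by (simp add: d_Suc[abs_def] mult.assoc)
  qed (simp add: d_def b)
  have B: "B \<ge> 0" using l2_le_nonneg[OF b] .
  have geo: "summable (\<lambda>m. q ^ m * B)" "(\<Sum>m. q ^ m * B) = B / (1 - q)"
  proof -
    have "(\<lambda>m. q ^ m * B) sums (1 / (1 - q) * B)"
      using R by (intro sums_mult2 geometric_sums) simp
    then show "summable (\<lambda>m. q ^ m * B)" "(\<Sum>m. q ^ m * B) = B / (1 - q)"
      by (auto simp: sums_iff)
  qed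
  have pt: "cmod (d m k) \<le> q ^ m * B" if "k \<in> I" for m k
    by (rule l2_le_point[OF d that])
  have sums_d: "summable (\<lambda>m. cmod (d m k))" if "k \<in> I" for k
    by (rule summable_comparison_test'[OF geo(1), of 0]) (use pt[OF that] in auto)
  have sum_d: "summable (\<lambda>m. d m k)" if "k \<in> I" for k
    by (rule summable_norm_cancel[OF sums_d[OF that]])
  define x where "x k = (\<Sum>m. d m k)" for k
  have "l2_le I x (B / (1 - q))"
    unfolding l2_le_def
  proof (intro allI impI)
    fix K assume K: "finite K" "K \<subseteq> I"
    have lim: "(\<lambda>M. \<Sum>m<M. d m k) \<longlonglongrightarrow> x k" if "k \<in> K" for k
      unfolding x_def using summable_LIMSEQ[OF sum_d] K that by blast
    have "(\<lambda>M. L2_set (\<lambda>k. cmod (\<Sum>m<M. d m k)) K) \<longlonglongrightarrow> L2_set (\<lambda>k. cmod (x k)) K"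
      unfolding L2_set_def by (intro tendsto_real_sqrt tendsto_sum tendsto_power tendsto_norm lim)
    then show "L2_set (\<lambda>k. cmod (x k)) K \<le> B / (1 - q)"
    proof (rule tendsto_upperbound)
      have partial: "L2_set (\<lambda>k. cmod (\<Sum>m<M. d m k)) K \<le> (\<Sum>m<M. q ^ m * B)" for M
      proof (induction M)
        case (Suc M)
        have "L2_set (\<lambda>k. cmod (\<Sum>m<Suc M. d m k)) K \<le> L2_set (\<lambda>k. cmod (\<Sum>m<M. d m k) + cmod (d M k)) K"
          by (intro L2_set_mono) (auto intro: norm_triangle_ineq)
        also have "\<dots> \<le> L2_set (\<lambda>k. cmod (\<Sum>m<M. d m k)) K + L2_set (\<lambda>k. cmod (d M k)) K"
          by (rule L2_set_triangle_ineq)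
        also have "\<dots> \<le> (\<Sum>m<Suc M. q ^ m * B)"
          using Suc d[of M] K by (auto simp: l2_le_def)
        finally show ?case .
      qed (simp add: L2_set_def)
      have total: "(\<Sum>m<M. q ^ m * B) \<le> B / (1 - q)" for M
        using sum_le_suminf[OF geo(1), of "{..<M}"] geo(2) R B by simp
      show "\<forall>\<^sub>F M in sequentially. L2_set (\<lambda>k. cmod (\<Sum>m<M. d m k)) K \<le> B / (1 - q)"
        by (rule always_eventually) (blast intro: order_trans[OF partial total])
    qed simp
  qed
  moreover have "x k = b k + (\<Sum>\<^sub>\<infinity>l\<in>I. R k l * x l)" if k: "k \<in> I" for k
  proof -
    have inf_d: "((\<lambda>m. d m l) has_sum x l) UNIV" if "l \<in> I" for l
      unfolding x_def by (rule norm_summable_imp_has_sum[OF sums_d[OF that] summable_sums[OF sum_d[OF that]]])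
    \<comment> \<open>Shifting the index drops the term \<open>d 0 = b\<close>.\<close>
    have inf_Suc: "((\<lambda>m. d (Suc m) k) has_sum (x k - b k)) UNIV"
    proof -
      have "(\<lambda>m. d (Suc m) k) sums (x k - b k)"
        using summable_sums[OF sum_d[OF k]] by (subst sums_Suc_iff) (simp add: x_def d_def)
      moreover have "summable (\<lambda>m. cmod (d (Suc m) k))" using sums_d[OF k] by (subst summable_Suc_iff)
      ultimately show ?thesis by (rule norm_summable_imp_has_sum[rotated])
    qed
    \<comment> \<open>Absolute summability over pairs, the condition for the exchange: the majorant
      is a geometric sequence times a summable row.\<close>
    have prod: "(\<lambda>(m, l). R k l * d m l) summable_on (UNIV \<times> I)"
    proof (rule abs_summable_summable[OF summable_on_comparison_test])
      have "((\<lambda>l. (q ^ m * B) * cmod (R k l)) has_sum ((q ^ m * B) * infsum (\<lambda>l. cmod (R k l)) I)) I" for m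
        by (intro has_sum_cmult_right has_sum_infsum rows k)
      moreover have "(\<lambda>m. (q ^ m * B) * infsum (\<lambda>l. cmod (R k l)) I) summable_on UNIV"
        using R B by (intro summable_on_cmult_left summable_nonneg_imp_summable_on geo) auto
      ultimately show "(\<lambda>(m, l). (q ^ m * B) * cmod (R k l)) summable_on (UNIV \<times> I)"
        using R B by (intro summable_on_SigmaI[where g="\<lambda>m. (q ^ m * B) * infsum (\<lambda>l. cmod (R k l)) I"]) auto
    next
      fix p :: "nat \<times> 'a" assume "p \<in> UNIV \<times> I"
      then obtain m l where p: "p = (m, l)" "l \<in> I" by auto
      have "norm (R k l * d m l) \<le> (q ^ m * B) * cmod (R k l)"
        using pt[OF p(2), of m] by (subst norm_mult, subst mult.commute) (rule mult_right_mono, auto)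
      then show "norm (case p of (m, l) \<Rightarrow> R k l * d m l) \<le> (case p of (m, l) \<Rightarrow> (q ^ m * B) * cmod (R k l))"
        by (simp add: p)
    qed simp
    have "x k - b k = (\<Sum>\<^sub>\<infinity>m. d (Suc m) k)" using inf_Suc by (simp add: infsumI)
    also have "\<dots> = (\<Sum>\<^sub>\<infinity>l\<in>I. \<Sum>\<^sub>\<infinity>m. R k l * d m l)"
      unfolding d_Suc by (rule infsum_swap_banach[OF prod])
    also have "\<dots> = (\<Sum>\<^sub>\<infinity>l\<in>I. R k l * x l)"
      by (intro infsum_cong) (auto intro!: infsumI has_sum_cmult_right inf_d)
    finally show ?thesis by (simp add: algebra_simps)
  qed
  ultimately show ?thesis by (rule that)
qed

section \<open>The variational problem in Fourier coefficients\<close>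

definition cvec :: "real ^ 'd \<Rightarrow> complex ^ 'd" where
  "cvec e = (\<chi> j. of_real (e $ j))"

lemma herm_scale_cvec: "herm (a *s cvec e) (b *s cvec f) = of_real (e \<bullet> f) * a * cnj b"
  by (simp add: herm_scale) (simp add: herm_def cvec_def inner_vec_def)

lemma norm_scale_cvec: "norm (a *s cvec e) = cmod a * norm e"
  by (simp add: norm_scale_vec) (simp add: cvec_def norm_vec_def)

lemma H_bar_0_1_iff:
  fixes U :: "int ^ 'n \<Rightarrow> complex"
  shows "U \<in> H_bar_0 P 1 \<longleftrightarrow> U 0 = 0 \<and> (\<lambda>k. (cmod (norm (P *v of_int_vec k) * U k))\<^sup>2) summable_on (- {0})"
  by (simp add: H_bar_0_def norm_mult power_mult_distrib)

lemma infsum_concentrated: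
  assumes "k \<in> I" "\<And>j. j \<in> I \<Longrightarrow> j \<noteq> k \<Longrightarrow> f j = 0"
  shows "infsum f I = f k"
  by (rule infsumI, rule has_sum_finite_neutralI[where B="{k}"]) (use assms in auto)

lemma l2_le_cong:
  assumes "l2_le I x B" and eq: "\<And>k. k \<in> I \<Longrightarrow> x k = y k"
  shows "l2_le I y B"
  unfolding l2_le_def
proof (intro allI impI)
  fix K assume K: "finite K" "K \<subseteq> I"
  then have "L2_set (\<lambda>k. cmod (y k)) K = L2_set (\<lambda>k. cmod (x k)) K"
    using eq by (intro L2_set_cong) auto
  then show "L2_set (\<lambda>k. cmod (y k)) K \<le> B"
    using assms(1) K by (simp add: l2_le_def)
qed

text \<open>The locale fixes a nonvanishing \<open>P k\<close> and some summable majorant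
  \<open>m\<close> of the Fourier coefficients. A concrete decay rate enters in
  \<open>ex_weighted_solution\<close>, the Diophantine bound in the final theorem.\<close>

locale variational_problem =
  fixes P :: "real ^ 'n ^ 'd" and A :: "real ^ 'n \<Rightarrow> real" and \<alpha>\<^sub>0 \<alpha>\<^sub>1 :: real and m :: "int ^ 'n \<Rightarrow> real"
  assumes P_nonzero: "\<And>k. k \<noteq> 0 \<Longrightarrow> P *v of_int_vec k \<noteq> 0"
    and A_meas: "A \<in> borel_measurable lebesgue"
    and \<alpha>\<^sub>0: "0 < \<alpha>\<^sub>0" and A_bounds: "\<And>y. \<alpha>\<^sub>0 \<le> A y" "\<And>y. A y \<le> \<alpha>\<^sub>1"
    and A_coeff: "\<And>k. cmod (fourier_coeff (\<lambda>y. complex_of_real (A y)) k) \<le> m k"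
    and m_summable: "m summable_on UNIV"
begin

definition freq :: "int ^ 'n \<Rightarrow> real" where
  "freq k = norm (P *v of_int_vec k)"

text \<open>Normalizing to unit vectors moves the size of \<open>P k\<close> into
  \<open>freq\<close>, so that \<open>M\<close> is bounded by \<open>m\<close>. At
  \<open>k = 0\<close> the value is 0, and later sums run over nonzero frequencies.\<close>

definition dir :: "int ^ 'n \<Rightarrow> real ^ 'd" where
  "dir k = (1 / freq k) *\<^sub>R (P *v of_int_vec k)"

definition M :: "int ^ 'n \<Rightarrow> int ^ 'n \<Rightarrow> complex" where
  "M k l = fourier_coeff (\<lambda>y. complex_of_real (A y)) (k - l) * of_real (dir l \<bullet> dir k)"

definition Q :: "int ^ 'n \<Rightarrow> int ^ 'n \<Rightarrow> complex" where
  "Q k l = (if k = l then 1 else 0) - M k l / of_real \<alpha>\<^sub>1"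

lemma \<alpha>\<^sub>1: "0 < \<alpha>\<^sub>1" "\<alpha>\<^sub>0 \<le> \<alpha>\<^sub>1"
  using \<alpha>\<^sub>0 A_bounds[of undefined] by linarith+

lemma m_nonneg: "0 \<le> m k"
  using A_coeff[of k] norm_ge_zero order_trans by blast

lemma freq_pos: "k \<noteq> 0 \<Longrightarrow> 0 < freq k"
  using P_nonzero by (simp add: freq_def)

lemma norm_dir: "k \<noteq> 0 \<Longrightarrow> norm (dir k) = 1"
  using freq_pos[of k] by (simp add: dir_def freq_def)

lemma dir_self: "k \<noteq> 0 \<Longrightarrow> dir k \<bullet> dir k = 1"
  by (simp add: norm_dir dot_square_norm)

lemma norm_M_le:
  assumes "k \<noteq> 0" "l \<noteq> 0"
  shows "cmod (M k l) \<le> m (k - l)"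
proof -
  have "\<bar>dir l \<bullet> dir k\<bar> \<le> 1"
    using Cauchy_Schwarz_ineq2[of "dir l" "dir k"] assms by (simp add: norm_dir)
  then have "cmod (M k l) \<le> m (k - l) * 1"
    unfolding M_def norm_mult by (intro mult_mono A_coeff m_nonneg) auto
  then show ?thesis by simp
qed

lemma A_complex_meas: "(\<lambda>y. complex_of_real (A y)) \<in> borel_measurable torus_measure"
  using A_meas by (simp cong: measurable_cong_sets)

lemma norm_A_le: "cmod (complex_of_real (A y)) \<le> \<alpha>\<^sub>1"
  using A_bounds[of y] \<alpha>\<^sub>0 by simp

lemma A_integrable: "integrable torus_measure (\<lambda>y. complex_of_real (A y))"
  by (rule integrable_torus_bounded[OF A_complex_meas norm_A_le])

section \<open>The form as a double sum over frequencies\<close>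

definition grad_coeff :: "(int ^ 'n \<Rightarrow> complex) \<Rightarrow> int ^ 'n \<Rightarrow> complex ^ 'd" where
  "grad_coeff U k = (\<i> * U k) *s cvec (P *v of_int_vec k)"

text \<open>Riesz-Fischer supplies a witness, so the choice in \<open>P_grad\<close> really selects
  an L^2 limit of the gradient series.\<close>

lemma P_grad_series:
  assumes "U \<in> H_bar_0 P 1"
  shows "L2_series (grad_coeff U) (P_grad P U)"
proof -
  have e: "(\<lambda>k. \<chi> j. \<i> * of_real ((P *v of_int_vec k) $ j) * U k) = grad_coeff U"
    by (simp add: fun_eq_iff vec_eq_iff grad_coeff_def cvec_def)
  have "(\<lambda>k. (norm (grad_coeff U k))\<^sup>2) summable_on (- {0})"
    using assms by (simp add: H_bar_0_1_iff grad_coeff_def norm_scale_cvec norm_mult mult_ac)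
  then obtain g where "L2_series (grad_coeff U) g"
    by (rule riesz_fischer) (auto simp: L2_series_def trig_def)
  then show ?thesis unfolding P_grad_def e by (rule someI[of "L2_series (grad_coeff U)" g])
qed

lemma l2_weight:
  fixes U :: "int ^ 'n \<Rightarrow> complex"
  shows "U \<in> H_bar_0 P 1 \<Longrightarrow> (\<lambda>k. (cmod (freq k * U k))\<^sup>2) summable_on (- {0})"
  by (simp add: H_bar_0_1_iff freq_def)

lemma pairing_summable:
  assumes "(\<lambda>k. (cmod (w k))\<^sup>2) summable_on (- {0})" "(\<lambda>k. (cmod (y k))\<^sup>2) summable_on (- {0})"
  shows "(\<lambda>(k, l). M k l * w l * cnj (y k)) summable_on ((- {0}) \<times> (- {0}))"
proof -
  have "(\<lambda>(k, l). cmod (M k l * w l * cnj (y k))) summable_on ((- {0}) \<times> (- {0}))"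
    by (rule convolution_pairing_summable[OF _ m_summable m_nonneg assms]) (simp add: norm_M_le)
  then show ?thesis
    unfolding case_prod_unfold by (rule abs_summable_summable)
qed

text \<open>Sums over squares \<open>K \<times> K\<close> converge to the form by L^2 continuity,
  and to the double series by absolute summability. The limits agree, and Fubini gives the iterated
  sum.\<close>

lemma form_a_eq:
  fixes U V :: "int ^ 'n \<Rightarrow> complex"
  assumes U: "U \<in> H_bar_0 P 1" and V: "V \<in> H_bar_0 P 1"
  shows "form_a A P U V = (\<Sum>\<^sub>\<infinity>k\<in>- {0}. (\<Sum>\<^sub>\<infinity>l\<in>- {0}. M k l * (freq l * U l)) * cnj (freq k * V k))"
proof -
  let ?I = "- {0} :: (int ^ 'n) set"
  let ?f = "\<lambda>(k, l). M k l * (freq l * U l) * cnj (freq k * V k)"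
  let ?T = "\<lambda>U K. trig (grad_coeff U) K"
  have g: "P_grad P W \<in> L2_torus"
    "((\<lambda>K. L2_norm (\<lambda>y. P_grad P W y - ?T W K y)) \<longlongrightarrow> 0) (finite_subsets_at_top ?I)" if "W \<in> H_bar_0 P 1" for W
  proof -
    note s = P_grad_series[OF that, unfolded L2_series_def]
    show "P_grad P W \<in> L2_torus" using s by simp
    have "((\<lambda>K. sqrt (LINT y|torus_measure. (norm (P_grad P W y - ?T W K y))\<^sup>2)) \<longlongrightarrow> sqrt 0) (finite_subsets_at_top ?I)"
      unfolding trig_def by (intro tendsto_real_sqrt conjunct2[OF s])
    then show "((\<lambda>K. L2_norm (\<lambda>y. P_grad P W y - ?T W K y)) \<longlongrightarrow> 0) (finite_subsets_at_top ?I)"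
      by (simp add: L2_norm_def)
  qed
  have sf: "?f summable_on (?I \<times> ?I)"
    by (rule pairing_summable[OF l2_weight[OF U] l2_weight[OF V]])
  \<comment> \<open>The imaginary units cancel against their conjugate, and the factors
    \<open>freq l\<close>, \<open>freq k\<close> undo the normalization in
    \<open>dir\<close>.\<close>
  have coeff: "fourier_coeff (\<lambda>y. complex_of_real (A y)) (k - l) * herm (grad_coeff U l) (grad_coeff V k) = ?f (k, l)"
    if "k \<noteq> 0" "l \<noteq> 0" for k l
    using freq_pos[OF that(1)] freq_pos[OF that(2)]
    by (simp add: grad_coeff_def herm_scale_cvec M_def dir_def mult_ac)
  have lim0: "((\<lambda>K. LINT y|torus_measure. complex_of_real (A y) * herm (?T U K y) (?T V K y))
      \<longlongrightarrow> (LINT y|torus_measure. complex_of_real (A y) * herm (P_grad P U y) (P_grad P V y))) (finite_subsets_at_top ?I)"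
    by (rule tendsto_weighted_herm[OF A_complex_meas norm_A_le g(1)[OF U] g(1)[OF V] trig_L2 trig_L2 g(2)[OF U] g(2)[OF V]])
  have form: "(LINT y|torus_measure. complex_of_real (A y) * herm (P_grad P U y) (P_grad P V y)) = form_a A P U V"
    unfolding form_a_def L2_inner_def herm_def sum_distrib_left
    by (simp only: vector_smult_component mult.assoc)
  have ev: "\<forall>\<^sub>F K in finite_subsets_at_top ?I.
      (LINT y|torus_measure. complex_of_real (A y) * herm (?T U K y) (?T V K y)) = sum ?f (K \<times> K)"
  proof (rule eventually_finite_subsets_at_top_weakI)
    fix K assume K: "finite K" "K \<subseteq> ?I"
    have "(LINT y|torus_measure. complex_of_real (A y) * herm (?T U K y) (?T V K y)) = (\<Sum>k\<in>K. \<Sum>l\<in>K. ?f (k, l))"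
      unfolding integral_herm_trig[OF A_integrable]
      by (intro sum.cong refl coeff) (use K in auto)
    then show "(LINT y|torus_measure. complex_of_real (A y) * herm (?T U K y) (?T V K y)) = sum ?f (K \<times> K)"
      by (simp add: sum.cartesian_product)
  qed
  have lim1: "((\<lambda>K. sum ?f (K \<times> K)) \<longlongrightarrow> form_a A P U V) (finite_subsets_at_top ?I)"
    by (rule tendsto_cong[THEN iffD1, OF ev lim0[unfolded form]])
  \<comment> \<open>Squares are cofinal among the finite sets of pairs: a finite \<open>S\<close>
    lies in the square over the union of its two projections.\<close>
  have "filterlim (\<lambda>K. K \<times> K) (finite_subsets_at_top (?I \<times> ?I)) (finite_subsets_at_top ?I)"
    unfolding filterlim_def le_filter_def eventually_filtermap
  proof (intro allI impI)
    fix R assume "\<forall>\<^sub>F S in finite_subsets_at_top (?I \<times> ?I). R S"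
    then have "\<exists>S. finite S \<and> S \<subseteq> ?I \<times> ?I \<and> (\<forall>T. finite T \<and> S \<subseteq> T \<and> T \<subseteq> ?I \<times> ?I \<longrightarrow> R T)"
      by (simp only: eventually_finite_subsets_at_top)
    then obtain S where S: "finite S" "S \<subseteq> ?I \<times> ?I" "\<forall>T. finite T \<and> S \<subseteq> T \<and> T \<subseteq> ?I \<times> ?I \<longrightarrow> R T"
      by (elim exE conjE)
    have S': "finite (fst ` S \<union> snd ` S)" "fst ` S \<union> snd ` S \<subseteq> ?I"
      using S(1,2) by auto
    have "R (K \<times> K)" if K: "finite K" "fst ` S \<union> snd ` S \<subseteq> K" "K \<subseteq> ?I" for K
    proof -
      have "S \<subseteq> K \<times> K"
      proof
        fix p assume "p \<in> S"
        then have "fst p \<in> K" "snd p \<in> K" using K(2) by auto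
        then show "p \<in> K \<times> K" by (simp add: mem_Times_iff)
      qed
      moreover have "finite (K \<times> K)" "K \<times> K \<subseteq> ?I \<times> ?I"
        using K by (simp, intro Sigma_mono K(3))
      ultimately show ?thesis using S(3)[THEN spec, of "K \<times> K"] by (simp only: simp_thms)
    qed
    with S' show "\<forall>\<^sub>F K in finite_subsets_at_top ?I. R (K \<times> K)"
      unfolding eventually_finite_subsets_at_top by (intro exI[of _ "fst ` S \<union> snd ` S"]) simp
  qed
  then have "((\<lambda>K. sum ?f (K \<times> K)) \<longlongrightarrow> infsum ?f (?I \<times> ?I)) (finite_subsets_at_top ?I)"
    by (rule filterlim_compose[OF infsum_tendsto[OF sf]])
  from tendsto_unique[OF finite_subsets_at_top_neq_bot lim1 this]
  have "form_a A P U V = infsum ?f (?I \<times> ?I)" .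
  also have "\<dots> = (\<Sum>\<^sub>\<infinity>k\<in>?I. \<Sum>\<^sub>\<infinity>l\<in>?I. M k l * (freq l * U l) * cnj (freq k * V k))"
    by (rule infsum_Sigma'_banach[OF sf, symmetric])
  also have "\<dots> = (\<Sum>\<^sub>\<infinity>k\<in>?I. (\<Sum>\<^sub>\<infinity>l\<in>?I. M k l * (freq l * U l)) * cnj (freq k * V k))"
    by (simp only: infsum_cmult_left')
  finally show ?thesis .
qed

text \<open>Testing with a single Fourier mode isolates one row of the system; conversely, the rows
  recombine through \<open>form_a_eq\<close>.\<close>

lemma variational_solution_iff:
  fixes U F :: "int ^ 'n \<Rightarrow> complex"
  assumes U: "U \<in> H_bar_0 P 1"
  shows "variational_solution A P F U \<longleftrightarrow>
    (\<forall>k. k \<noteq> 0 \<longrightarrow> (\<Sum>\<^sub>\<infinity>l\<in>- {0}. M k l * (freq l * U l)) = F k / freq k)"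
    (is "_ \<longleftrightarrow> (\<forall>k. k \<noteq> 0 \<longrightarrow> ?S k = _)")
proof
  assume sol: "variational_solution A P F U"
  show "\<forall>k. k \<noteq> 0 \<longrightarrow> ?S k = F k / freq k"
  proof (intro allI impI)
    fix k :: "int ^ 'n" assume k: "k \<noteq> 0"
    define V :: "int ^ 'n \<Rightarrow> complex" where "V l = (if l = k then 1 else 0)" for l
    have V: "V \<in> H_bar_0 P 1"
      unfolding H_bar_0_1_iff
      by (auto simp: V_def k intro!: finite_nonzero_values_imp_summable_on intro: finite_subset[of _ "{k}"])
    have "form_a A P U V = dual_pairing F V"
      using sol V by (simp add: variational_solution_def)
    moreover have "dual_pairing F V = F k"
      unfolding dual_pairing_def using k by (subst infsum_concentrated[of k]) (auto simp: V_def)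
    moreover have "form_a A P U V = ?S k * freq k"
      unfolding form_a_eq[OF U V] using k by (subst infsum_concentrated[of k]) (auto simp: V_def)
    ultimately show "?S k = F k / freq k"
      using freq_pos[OF k] by (simp add: field_simps)
  qed
next
  assume eq: "\<forall>k. k \<noteq> 0 \<longrightarrow> ?S k = F k / freq k"
  \<comment> \<open>The two series agree term by term, so no convergence of the dual pairing has to
    be shown.\<close>
  have "form_a A P U V = dual_pairing F V" if V: "V \<in> H_bar_0 P 1" for V
    unfolding form_a_eq[OF U V] dual_pairing_def
    using eq freq_pos by (intro infsum_cong) (auto simp: less_imp_neq[THEN not_sym])
  then show "variational_solution A P F U"
    using U by (simp add: variational_solution_def)
qed

text \<open>\<open>Q\<close> compresses multiplication by \<open>1 - A / \<alpha>\<^sub>1\<close>, whose sup norm is at most \<open>1 - \<alpha>\<^sub>0 / \<alpha>\<^sub>1\<close>.\<close>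

lemma sections_le_Q: "sections_le (- {0}) Q (1 - \<alpha>\<^sub>0 / \<alpha>\<^sub>1)"
  unfolding sections_le_def
proof (intro allI impI)
  fix K L :: "(int ^ 'n) set" and x
  assume KL: "finite K" "K \<subseteq> - {0}" "finite L" "L \<subseteq> - {0}"
  \<comment> \<open>Duality: the image of \<open>x\<close> is itself the test vector, so the pairing
    equals \<open>Z\<^sup>2\<close> and is bounded by the contraction factor times
    \<open>X * Z\<close>.\<close>
  define z where "z k = (\<Sum>l\<in>L. Q k l * x l)" for k
  define u where "u l = x l *s cvec (dir l)" for l
  define v where "v k = z k *s cvec (dir k)" for k
  define B where "B y = 1 - complex_of_real (A y) / of_real \<alpha>\<^sub>1" for y
  define X where "X = L2_set (\<lambda>l. cmod (x l)) L"
  define Z where "Z = L2_set (\<lambda>k. cmod (z k)) K"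
  have B_real: "B y = of_real (1 - A y / \<alpha>\<^sub>1)" for y by (simp add: B_def)
  have B_bd: "cmod (B y) \<le> 1 - \<alpha>\<^sub>0 / \<alpha>\<^sub>1" for y
    unfolding B_real norm_of_real using A_bounds[of y] \<alpha>\<^sub>1 by (simp add: field_simps)
  have B_meas [measurable]: "B \<in> borel_measurable torus_measure"
    unfolding B_def using A_complex_meas by measurable
  have B_int: "integrable torus_measure B"
    by (rule integrable_torus_bounded[OF B_meas B_bd])
  have B_coeff: "fourier_coeff B j = (if j = 0 then 1 else 0) - fourier_coeff (\<lambda>y. complex_of_real (A y)) j / \<alpha>\<^sub>1" for j
  proof -
    have i1: "integrable torus_measure (\<lambda>y. cnj (character j y))"
      by (rule integrable_torus_bounded[where B=1]) (auto simp: cnj_character)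
    have i2: "integrable torus_measure (\<lambda>y. complex_of_real (A y) * cnj (character j y))"
      by (rule Bochner_Integration.integrable_bound[OF A_integrable])
        (use A_complex_meas in \<open>auto simp: norm_mult cnj_character\<close>)
    have "fourier_coeff B j = (LINT y|torus_measure. 1 * cnj (character j y) - complex_of_real (A y) * cnj (character j y) / of_real \<alpha>\<^sub>1)"
      unfolding fourier_coeff_def B_def by (intro Bochner_Integration.integral_cong) (auto simp: algebra_simps)
    also have "\<dots> = fourier_coeff (\<lambda>_. 1) j - fourier_coeff (\<lambda>y. complex_of_real (A y)) j / \<alpha>\<^sub>1"
      unfolding fourier_coeff_def using i1 i2 by simp
    finally show ?thesis by (simp add: fourier_coeff_1)
  qed
  have norms: "L2_norm (trig u L) = X" "L2_norm (trig v K) = Z"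
    unfolding X_def Z_def L2_norm_trig[OF KL(3)] L2_norm_trig[OF KL(1)]
    by (intro L2_set_cong refl; use KL norm_dir in \<open>force simp: u_def v_def norm_scale_cvec\<close>)+
  have "(LINT y|torus_measure. B y * herm (trig u L y) (trig v K y)) = (\<Sum>k\<in>K. \<Sum>l\<in>L. fourier_coeff B (k - l) * herm (u l) (v k))"
    by (rule integral_herm_trig[OF B_int])
  also have "\<dots> = (\<Sum>k\<in>K. \<Sum>l\<in>L. Q k l * x l * cnj (z k))"
  proof (intro sum.cong refl)
    fix k l assume "k \<in> K" "l \<in> L"
    then have "k \<noteq> 0" "l \<noteq> 0" using KL by auto
    then show "fourier_coeff B (k - l) * herm (u l) (v k) = Q k l * x l * cnj (z k)"
      \<comment> \<open>On the diagonal \<open>dir_self\<close> makes the Kronecker part exactly 1,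
        as in \<open>Q\<close>.\<close>
      by (auto simp: B_coeff u_def v_def herm_scale_cvec Q_def M_def dir_self algebra_simps)
  qed
  also have "\<dots> = (\<Sum>k\<in>K. z k * cnj (z k))"
    by (simp add: z_def sum_distrib_right)
  also have "\<dots> = of_real (\<Sum>k\<in>K. (cmod (z k))\<^sup>2)"
    by (simp only: of_real_sum complex_norm_square)
  also have "\<dots> = of_real (Z\<^sup>2)"
    by (simp add: Z_def L2_set_def sum_nonneg)
  finally have "(LINT y|torus_measure. B y * herm (trig u L y) (trig v K y)) = of_real (Z\<^sup>2)" .
  then have "cmod (of_real (Z\<^sup>2)) \<le> (1 - \<alpha>\<^sub>0 / \<alpha>\<^sub>1) * (X * Z)"
    using weighted_herm_bound(2)[OF B_meas B_bd trig_L2 trig_L2, of u L v K] norms by simp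
  then have "Z\<^sup>2 \<le> (1 - \<alpha>\<^sub>0 / \<alpha>\<^sub>1) * (X * Z)"
    by (simp only: norm_of_real abs_power2)
  then have "Z * Z \<le> ((1 - \<alpha>\<^sub>0 / \<alpha>\<^sub>1) * X) * Z"
    by (simp only: power2_eq_square mult.assoc)
  moreover have "0 \<le> (1 - \<alpha>\<^sub>0 / \<alpha>\<^sub>1) * X" "0 \<le> Z"
    using \<alpha>\<^sub>1 by (auto simp: X_def Z_def)
  ultimately have "Z \<le> (1 - \<alpha>\<^sub>0 / \<alpha>\<^sub>1) * X"
    by (cases "Z = 0") (auto simp: mult_le_cancel_right)
  then show "L2_set (\<lambda>k. cmod (\<Sum>l\<in>L. Q k l * x l)) K \<le> (1 - \<alpha>\<^sub>0 / \<alpha>\<^sub>1) * L2_set (\<lambda>l. cmod (x l)) L"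
    by (simp add: Z_def X_def z_def)
qed

section \<open>Summable rows and uniqueness\<close>

lemma contraction_factor: "0 \<le> 1 - \<alpha>\<^sub>0 / \<alpha>\<^sub>1" "1 - \<alpha>\<^sub>0 / \<alpha>\<^sub>1 < 1"
  using \<alpha>\<^sub>0 \<alpha>\<^sub>1 by auto

lemma M_row_summable: "k \<noteq> 0 \<Longrightarrow> (\<lambda>l. cmod (M k l)) summable_on (- {0})"
  by (rule summable_on_comparison_test[OF summable_on_subset[OF has_sum_imp_summable[OF has_sum_shift(1)[OF m_summable, of k]]]])
    (auto intro: norm_M_le)

lemma Q_row_summable:
  assumes "k \<noteq> 0"
  shows "(\<lambda>l. cmod (Q k l)) summable_on (- {0})"
proof (rule summable_on_comparison_test)
  show "(\<lambda>l. (if k = l then 1 else 0) + cmod (M k l) / \<alpha>\<^sub>1) summable_on (- {0})"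
    unfolding divide_inverse
    by (intro summable_on_add summable_on_cmult_left M_row_summable assms finite_nonzero_values_imp_summable_on)
      (auto intro: finite_subset[of _ "{k}"])
  show "cmod (Q k l) \<le> (if k = l then 1 else 0) + cmod (M k l) / \<alpha>\<^sub>1" for l
    unfolding Q_def using \<alpha>\<^sub>1 by (intro order_trans[OF norm_triangle_ineq4]) (auto simp: norm_divide)
qed simp

text \<open>The bound on \<open>w\<close> makes the rows of \<open>M\<close> converge against it,
  which allows the identity part to be split off from the infinite sum.\<close>

lemma infsum_Q:
  fixes w :: "int ^ 'n \<Rightarrow> complex"
  assumes k: "k \<noteq> 0" and w: "l2_le (- {0}) w B"
  shows "(\<Sum>\<^sub>\<infinity>l\<in>- {0}. Q k l * w l) = w k - (\<Sum>\<^sub>\<infinity>l\<in>- {0}. M k l * w l) / \<alpha>\<^sub>1"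
proof -
  have 1: "((\<lambda>l. if l = k then w k else 0) has_sum w k) (- {0})"
    using k by (intro has_sum_finite_neutralI[where B="{k}"]) auto
  have "(\<lambda>l. M k l * w l) summable_on (- {0})"
    using row_product_summable[of M, OF M_row_summable[OF k] w] by (rule abs_summable_summable)
  then have 2: "((\<lambda>l. - (1 / \<alpha>\<^sub>1) * (M k l * w l)) has_sum - (1 / \<alpha>\<^sub>1) * (\<Sum>\<^sub>\<infinity>l\<in>- {0}. M k l * w l)) (- {0})"
    by (intro has_sum_cmult_right has_sum_infsum)
  have "((\<lambda>l. Q k l * w l) has_sum (w k + - (1 / \<alpha>\<^sub>1) * (\<Sum>\<^sub>\<infinity>l\<in>- {0}. M k l * w l))) (- {0})"
    using has_sum_add[OF 1 2] by (rule has_sum_cong[THEN iffD1, rotated]) (auto simp: Q_def algebra_simps)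
  then show ?thesis by (simp add: infsumI)
qed

text \<open>The rescaled difference \<open>w\<close> of two solutions satisfies
  \<open>M w = 0\<close>, hence \<open>Q w = w\<close>, and a strict contraction fixes only
  0.\<close>

lemma variational_solution_unique:
  fixes U V :: "int ^ 'n \<Rightarrow> complex"
  assumes "variational_solution A P F U" "variational_solution A P F V"
  shows "U = V"
proof -
  have H: "U \<in> H_bar_0 P 1" "V \<in> H_bar_0 P 1" using assms by (auto simp: variational_solution_def)
  define w where "w k = freq k * U k - freq k * V k" for k
  obtain B1 B2 where B: "l2_le (- {0}) (\<lambda>k. freq k * U k) B1" "l2_le (- {0}) (\<lambda>k. freq k * V k) B2"
    using l2_le_iff_summable[THEN iffD2, OF l2_weight[OF H(1)]] l2_le_iff_summable[THEN iffD2, OF l2_weight[OF H(2)]]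
    by blast
  have w: "l2_le (- {0}) w (B1 + B2)"
    unfolding l2_le_def
  proof (intro allI impI)
    fix K :: "(int ^ 'n) set" assume K: "finite K" "K \<subseteq> - {0}"
    have "L2_set (\<lambda>k. cmod (w k)) K \<le> L2_set (\<lambda>k. cmod (freq k * U k) + cmod (freq k * V k)) K"
      unfolding w_def by (intro L2_set_mono norm_triangle_ineq4) auto
    also have "\<dots> \<le> L2_set (\<lambda>k. cmod (freq k * U k)) K + L2_set (\<lambda>k. cmod (freq k * V k)) K"
      by (rule L2_set_triangle_ineq)
    also have "\<dots> \<le> B1 + B2" using B K unfolding l2_le_def by (intro add_mono) auto
    finally show "L2_set (\<lambda>k. cmod (w k)) K \<le> B1 + B2" .
  qed
  have Mw: "(\<Sum>\<^sub>\<infinity>l\<in>- {0}. M k l * w l) = 0" if k: "k \<noteq> 0" for k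
  proof -
    have s: "(\<lambda>l. M k l * (freq l * U l)) summable_on (- {0})" "(\<lambda>l. M k l * (freq l * V l)) summable_on (- {0})"
      by (rule abs_summable_summable[OF row_product_summable[of M, OF M_row_summable[OF k] B(1)]],
          rule abs_summable_summable[OF row_product_summable[of M, OF M_row_summable[OF k] B(2)]])
    have "(\<Sum>\<^sub>\<infinity>l\<in>- {0}. M k l * w l) = (\<Sum>\<^sub>\<infinity>l\<in>- {0}. M k l * (freq l * U l) + - (M k l * (freq l * V l)))"
      by (simp add: w_def algebra_simps)
    also have "\<dots> = (\<Sum>\<^sub>\<infinity>l\<in>- {0}. M k l * (freq l * U l)) - (\<Sum>\<^sub>\<infinity>l\<in>- {0}. M k l * (freq l * V l))"
      by (subst infsum_add[OF s(1)]) (use s(2) in \<open>simp_all add: summable_on_uminus infsum_uminus\<close>)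
    also have "\<dots> = 0"
      using assms k by (simp add: variational_solution_iff[OF H(1)] variational_solution_iff[OF H(2)])
    finally show ?thesis .
  qed
  define q where "q = 1 - \<alpha>\<^sub>0 / \<alpha>\<^sub>1"
  \<comment> \<open>Each application of \<open>Q\<close> reproduces \<open>w\<close> and gains a
    factor \<open>q\<close> in the bound.\<close>
  have wq: "l2_le (- {0}) w (q ^ j * (B1 + B2))" for j
  proof (induction j)
    case (Suc j)
    have "l2_le (- {0}) (\<lambda>k. \<Sum>\<^sub>\<infinity>l\<in>- {0}. Q k l * w l) (q * (q ^ j * (B1 + B2)))"
      unfolding q_def
      by (rule l2_le_apply[OF sections_le_Q contraction_factor(1) Q_row_summable Suc[unfolded q_def]]) simp
    then have "l2_le (- {0}) w (q * (q ^ j * (B1 + B2)))"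
    proof (rule l2_le_cong)
      fix k :: "int ^ 'n" assume "k \<in> - {0}"
      then have "k \<noteq> 0" by simp
      from infsum_Q[OF this w] Mw[OF this] show "(\<Sum>\<^sub>\<infinity>l\<in>- {0}. Q k l * w l) = w k"
        by simp
    qed
    then show ?case by (simp add: mult.assoc)
  qed (simp add: w)
  have "w k = 0" if k: "k \<noteq> 0" for k
  proof -
    have "(\<lambda>j. q ^ j * (B1 + B2)) \<longlonglongrightarrow> 0 * (B1 + B2)"
      using contraction_factor unfolding q_def
      by (intro tendsto_mult tendsto_const LIMSEQ_realpow_zero)
    moreover have "cmod (w k) \<le> q ^ j * (B1 + B2)" for j
      using k by (intro l2_le_point[OF wq]) simp
    ultimately have "cmod (w k) \<le> 0 * (B1 + B2)"
      by (intro LIMSEQ_le_const) auto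
    then show ?thesis by simp
  qed
  then have "freq k * (U k - V k) = 0" if "k \<noteq> 0" for k
    using that unfolding w_def right_diff_distrib by blast
  then have "U k = V k" if "k \<noteq> 0" for k
    using that freq_pos[OF that] by (metis eq_iff_diff_eq_0 less_irrefl mult_eq_0_iff of_real_eq_0_iff)
  moreover have "U 0 = V 0" using H by (simp add: H_bar_0_def)
  ultimately show ?thesis by (intro ext) (case_tac "x = 0", auto)
qed

end

section \<open>Weighted estimates and the main theorem\<close>

text \<open>For fixed positive \<open>\<epsilon>\<close> this is equivalent to the usual Sobolev
  weight; a small \<open>\<epsilon>\<close> makes it vary slowly between neighbouring
  frequencies.\<close>

definition weight :: "real \<Rightarrow> real \<Rightarrow> int ^ 'n \<Rightarrow> real" where
  "weight \<epsilon> \<sigma> k = (1 + \<epsilon> * norm (of_int_vec k)) powr \<sigma>"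

lemma weight_ge_1: "0 \<le> \<epsilon> \<Longrightarrow> 0 \<le> \<sigma> \<Longrightarrow> 1 \<le> weight \<epsilon> \<sigma> k"
  unfolding weight_def by (intro ge_one_powr_ge_zero) auto

text \<open>Submultiplicativity, from the triangle inequality and
  \<open>1 + a + b \<le> (1 + a) * (1 + b)\<close> for nonnegative \<open>a\<close>,
  \<open>b\<close>.\<close>

lemma weight_le_mult:
  assumes "0 \<le> \<epsilon>" "0 \<le> \<sigma>"
  shows "weight \<epsilon> \<sigma> k \<le> weight \<epsilon> \<sigma> (k - l) * weight \<epsilon> \<sigma> l"
proof -
  have "norm (of_int_vec k) \<le> norm (of_int_vec (k - l)) + norm (of_int_vec l)"
    using norm_triangle_ineq[of "of_int_vec (k - l)" "of_int_vec l"] by (simp add: of_int_vec_diff)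
  then have "1 + \<epsilon> * norm (of_int_vec k) \<le> 1 + \<epsilon> * (norm (of_int_vec (k - l)) + norm (of_int_vec l))"
    using assms by (intro add_left_mono mult_left_mono)
  also have "\<dots> \<le> (1 + \<epsilon> * norm (of_int_vec (k - l))) * (1 + \<epsilon> * norm (of_int_vec l))"
    using assms by (simp add: algebra_simps)
  finally have "weight \<epsilon> \<sigma> k \<le> ((1 + \<epsilon> * norm (of_int_vec (k - l))) * (1 + \<epsilon> * norm (of_int_vec l))) powr \<sigma>"
    unfolding weight_def using assms by (intro powr_mono2) auto
  also have "\<dots> = weight \<epsilon> \<sigma> (k - l) * weight \<epsilon> \<sigma> l"
    unfolding weight_def by (rule powr_mult)
  finally show ?thesis .
qed

lemma weight_diff_commute: "weight \<epsilon> \<sigma> (k - l) = weight \<epsilon> \<sigma> (l - k)"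
  by (simp add: weight_def of_int_vec_diff norm_minus_commute)

text \<open>Submultiplicativity applied both ways puts the ratio between \<open>1 / R\<close> and
  \<open>R\<close>, and \<open>1 / R\<close> is at least \<open>2 - R\<close>.\<close>

lemma weight_ratio:
  assumes "0 \<le> \<epsilon>" "0 \<le> \<sigma>"
  shows "\<bar>weight \<epsilon> \<sigma> k / weight \<epsilon> \<sigma> l - 1\<bar> \<le> weight \<epsilon> \<sigma> (k - l) - 1"
proof -
  define R where "R = weight \<epsilon> \<sigma> (k - l)"
  define x where "x = weight \<epsilon> \<sigma> k / weight \<epsilon> \<sigma> l"
  have pos: "0 < weight \<epsilon> \<sigma> j" for j :: "int ^ 'n" using weight_ge_1[OF assms, of j] by linarith
  have R: "1 \<le> R" unfolding R_def by (rule weight_ge_1[OF assms])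
  have "x \<le> R"
    using weight_le_mult[OF assms, of k l] pos[of l] by (simp add: x_def R_def pos_divide_le_eq)
  moreover have "1 \<le> R * x"
    using weight_le_mult[OF assms, of l k] pos[of l]
    by (simp add: x_def R_def weight_diff_commute[of _ _ l k] pos_le_divide_eq)
  \<comment> \<open>Equivalent to the square of \<open>R - 1\<close> being nonnegative.\<close>
  moreover have "2 - R \<le> x"
  proof (rule ccontr)
    assume "\<not> 2 - R \<le> x"
    then have "R * x < R * (2 - R)" using R by simp
    also have "\<dots> \<le> 1" using zero_le_power2[of "R - 1"] by (simp add: power2_eq_square algebra_simps)
    finally show False using \<open>1 \<le> R * x\<close> by simp
  qed
  ultimately show ?thesis by (simp add: x_def[symmetric] R_def[symmetric] abs_le_iff)
qed

section \<open>Solving the system in weighted spaces\<close>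

context variational_problem
begin

text \<open>For \<open>x = W * w\<close> the fixed point equation of the conjugated matrix
  \<open>Q + E\<close> with source \<open>W * g / \<alpha>\<^sub>1\<close> reads
  \<open>w = g / \<alpha>\<^sub>1 + Q w\<close>, which is \<open>M w = g\<close>.\<close>

lemma ex_weighted_solution:
  assumes C: "0 \<le> C" and mC: "\<And>k. m k \<le> C * (1 + norm (of_int_vec k)) powr (- N)"
    and \<sigma>: "0 \<le> \<sigma>" and N: "N > real CARD('n) + \<sigma>"
  obtains \<epsilon> where "0 < \<epsilon>" "\<epsilon> \<le> 1"
    "\<And>g :: int ^ 'n \<Rightarrow> complex. (\<lambda>k. (cmod (weight \<epsilon> \<sigma> k * g k))\<^sup>2) summable_on (- {0}) \<Longrightarrow>
      \<exists>w :: int ^ 'n \<Rightarrow> complex. (\<lambda>k. (cmod (weight \<epsilon> \<sigma> k * w k))\<^sup>2) summable_on (- {0})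
        \<and> (\<forall>k. k \<noteq> 0 \<longrightarrow> (\<Sum>\<^sub>\<infinity>l\<in>- {0}. M k l * w l) = g k)"
proof -
  define q where "q = 1 - \<alpha>\<^sub>0 / \<alpha>\<^sub>1"
  \<comment> \<open>Half of the gap between \<open>q\<close> and 1, so that the perturbed matrix is
    still a strict contraction.\<close>
  define \<delta> where "\<delta> = (\<alpha>\<^sub>0 / \<alpha>\<^sub>1) / 2"
  have \<delta>: "0 < \<delta>" "0 \<le> q" "q + \<delta> < 1"
    using \<alpha>\<^sub>0 \<alpha>\<^sub>1 contraction_factor by (auto simp: \<delta>_def q_def)
  have "0 \<le> C / \<alpha>\<^sub>1" using C \<alpha>\<^sub>1 by simp
  then obtain \<epsilon> where \<epsilon>: "0 < \<epsilon>" "\<epsilon> \<le> 1"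
    and kernel: "(\<lambda>j::int^'n. (weight \<epsilon> \<sigma> j - 1) * (C / \<alpha>\<^sub>1 * (1 + norm (of_int_vec j)) powr (- N))) summable_on UNIV"
    "(\<Sum>\<^sub>\<infinity>j::int^'n. (weight \<epsilon> \<sigma> j - 1) * (C / \<alpha>\<^sub>1 * (1 + norm (of_int_vec j)) powr (- N))) \<le> \<delta>"
    using exists_small_weight_defect[OF _ \<sigma> N \<delta>(1)] unfolding weight_def by blast
  define W :: "int ^ 'n \<Rightarrow> real" where "W = weight \<epsilon> \<sigma>"
  define \<kappa> where "\<kappa> j = (W j - 1) * (C / \<alpha>\<^sub>1 * (1 + norm (of_int_vec j)) powr (- N))" for j :: "int ^ 'n"
  have \<kappa>: "\<kappa> summable_on UNIV" "infsum \<kappa> UNIV \<le> \<delta>"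
    using kernel by (simp_all add: \<kappa>_def[abs_def] W_def)
  have W1: "1 \<le> W k" for k unfolding W_def using \<epsilon> \<sigma> by (intro weight_ge_1) auto
  have W0: "0 < W k" for k using W1[of k] by linarith
  have \<kappa>0: "0 \<le> \<kappa> j" for j
    unfolding \<kappa>_def using W1[of j] C \<alpha>\<^sub>1 by (intro mult_nonneg_nonneg) auto
  \<comment> \<open>The difference between \<open>Q\<close> conjugated by \<open>W\<close> and
    \<open>Q\<close> itself. It vanishes on the diagonal, so only the decaying entries of
    \<open>M\<close> contribute.\<close>
  define E :: "int ^ 'n \<Rightarrow> int ^ 'n \<Rightarrow> complex" where "E k l = of_real (W k / W l - 1) * Q k l" for k l
  have E_bd: "cmod (E k l) \<le> \<kappa> (k - l)" if kl: "k \<in> - {0}" "l \<in> - {0}" for k l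
  proof (cases "k = l")
    case True
    then show ?thesis using W0[of l] \<kappa>0[of "k - l"] by (simp add: E_def)
  next
    case False
    have "cmod (Q k l) = cmod (M k l) / \<alpha>\<^sub>1"
      using False \<alpha>\<^sub>1 by (simp add: Q_def norm_divide)
    also have "\<dots> \<le> (C * (1 + norm (of_int_vec (k - l))) powr (- N)) / \<alpha>\<^sub>1"
      using kl \<alpha>\<^sub>1 by (intro divide_right_mono order_trans[OF norm_M_le mC]) auto
    finally have "cmod (Q k l) \<le> C / \<alpha>\<^sub>1 * (1 + norm (of_int_vec (k - l))) powr (- N)" by simp
    moreover have "\<bar>W k / W l - 1\<bar> \<le> W (k - l) - 1"
      unfolding W_def using \<epsilon> \<sigma> by (intro weight_ratio) auto
    moreover have "0 \<le> W (k - l) - 1" using W1[of "k - l"] by simp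
    ultimately show ?thesis
      unfolding E_def \<kappa>_def norm_mult norm_of_real by (intro mult_mono) auto
  qed
  have sec: "sections_le (- {0}) (\<lambda>k l. Q k l + E k l) (q + infsum \<kappa> UNIV)"
    unfolding q_def by (intro sections_le_add sections_le_Q schur_test_convolution E_bd \<kappa> \<kappa>0)
  have rows: "(\<lambda>l. cmod (Q k l + E k l)) summable_on (- {0})" if "k \<in> - {0}" for k
  proof (rule summable_on_comparison_test)
    show "(\<lambda>l. cmod (Q k l) + \<kappa> (k - l)) summable_on (- {0})"
      using that by (intro summable_on_add Q_row_summable
          summable_on_subset[OF has_sum_imp_summable[OF has_sum_shift(1)[OF \<kappa>(1)]]]) auto
    show "cmod (Q k l + E k l) \<le> cmod (Q k l) + \<kappa> (k - l)" if "l \<in> - {0}" for l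
      using norm_triangle_ineq[of "Q k l" "E k l"] E_bd[OF \<open>k \<in> - {0}\<close> that] by linarith
  qed simp
  have QE: "Q k l + E k l = of_real (W k / W l) * Q k l" for k l
    by (simp add: E_def algebra_simps)
  have sum_nonneg: "0 \<le> infsum \<kappa> UNIV" by (intro infsum_nonneg \<kappa>0)
  have "\<exists>w :: int ^ 'n \<Rightarrow> complex. (\<lambda>k. (cmod (W k * w k))\<^sup>2) summable_on (- {0})
        \<and> (\<forall>k. k \<noteq> 0 \<longrightarrow> (\<Sum>\<^sub>\<infinity>l\<in>- {0}. M k l * w l) = g k)"
    if g: "(\<lambda>k. (cmod (W k * g k))\<^sup>2) summable_on (- {0})" for g :: "int ^ 'n \<Rightarrow> complex"
  proof -
    have "(\<lambda>k. (1 / \<alpha>\<^sub>1)\<^sup>2 * (cmod (W k * g k))\<^sup>2) summable_on (- {0})"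
      by (intro summable_on_cmult_right g)
    then have "(\<lambda>k. (cmod (W k * g k / \<alpha>\<^sub>1))\<^sup>2) summable_on (- {0})"
      by (simp add: norm_divide power_divide)
    then obtain B where B: "l2_le (- {0}) (\<lambda>k. W k * g k / \<alpha>\<^sub>1) B"
      using l2_le_iff_summable by blast
    obtain x where x: "l2_le (- {0}) x (B / (1 - (q + infsum \<kappa> UNIV)))"
      and x_eq: "\<And>k. k \<in> - {0} \<Longrightarrow> x k = W k * g k / \<alpha>\<^sub>1 + (\<Sum>\<^sub>\<infinity>l\<in>- {0}. (Q k l + E k l) * x l)"
      by (rule neumann_series[OF sec _ _ rows B]) (use \<delta> \<kappa> sum_nonneg in auto)
    define w where "w k = x k / W k" for k
    have xw: "x k = W k * w k" for k using W0[of k] by (simp add: w_def)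
    \<comment> \<open>Since \<open>W\<close> is at least 1, \<open>w\<close> inherits the bound on
      \<open>x\<close>; this is what \<open>infsum_Q\<close> requires.\<close>
    have w: "l2_le (- {0}) w (B / (1 - (q + infsum \<kappa> UNIV)))"
      unfolding l2_le_def
    proof (intro allI impI)
      fix K :: "(int ^ 'n) set" assume K: "finite K" "K \<subseteq> - {0}"
      have "L2_set (\<lambda>k. cmod (w k)) K \<le> L2_set (\<lambda>k. cmod (x k)) K"
      proof (intro L2_set_mono)
        fix k
        have "cmod (w k) * 1 \<le> cmod (w k) * W k" by (intro mult_left_mono W1) auto
        then show "cmod (w k) \<le> cmod (x k)"
          using W0[of k] by (simp add: xw norm_mult mult.commute)
      qed simp
      also have "\<dots> \<le> B / (1 - (q + infsum \<kappa> UNIV))" using x K by (simp add: l2_le_def)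
      finally show "L2_set (\<lambda>k. cmod (w k)) K \<le> B / (1 - (q + infsum \<kappa> UNIV))" .
    qed
    have "(\<lambda>k. (cmod (W k * w k))\<^sup>2) summable_on (- {0})"
      unfolding xw[symmetric] using x l2_le_iff_summable by blast
    moreover have "(\<Sum>\<^sub>\<infinity>l\<in>- {0}. M k l * w l) = g k" if k: "k \<noteq> 0" for k
    proof -
      have "(\<Sum>\<^sub>\<infinity>l\<in>- {0}. (Q k l + E k l) * x l) = (\<Sum>\<^sub>\<infinity>l\<in>- {0}. of_real (W k) * (Q k l * w l))"
        unfolding QE xw using W0 by (intro infsum_cong) (simp add: less_imp_neq[THEN not_sym])
      also have "\<dots> = of_real (W k) * (w k - (\<Sum>\<^sub>\<infinity>l\<in>- {0}. M k l * w l) / \<alpha>\<^sub>1)"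
        by (simp only: infsum_cmult_right' infsum_Q[OF k w])
      finally have "W k * w k = W k * (g k / \<alpha>\<^sub>1 + (w k - (\<Sum>\<^sub>\<infinity>l\<in>- {0}. M k l * w l) / \<alpha>\<^sub>1))"
        using x_eq[of k] k by (simp add: xw distrib_left)
      then have "w k = g k / \<alpha>\<^sub>1 + (w k - (\<Sum>\<^sub>\<infinity>l\<in>- {0}. M k l * w l) / \<alpha>\<^sub>1)"
        using W0[of k] by (subst (asm) mult_left_cancel) auto
      then show ?thesis using \<alpha>\<^sub>1 by (simp add: field_simps)
    qed
    ultimately show ?thesis by blast
  qed
  then show ?thesis using that[OF \<epsilon>] unfolding W_def by blast
qed

end

text \<open>Read \<open>r\<close> as the size of \<open>k\<close> and \<open>p\<close> as that of
  \<open>P k\<close>: \<open>1 / p\<close> is at most \<open>r powr \<tau> / c\<close>, so passing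
  from \<open>F\<close> to \<open>F / p\<close> in the weight of order \<open>s + \<tau>\<close>
  uses order \<open>2 * \<tau> + s\<close> of \<open>F\<close>.\<close>

lemma sobolev_weight_source:
  fixes r p c s \<tau> \<epsilon> :: real
  assumes "0 < r" "0 < c" "0 \<le> s" "0 < \<tau>" "0 < \<epsilon>" "\<epsilon> \<le> 1" and p: "c * r powr (- \<tau>) \<le> p"
  shows "((1 + \<epsilon> * r) powr (s + \<tau>) / p)\<^sup>2 \<le> 2 powr (2 * \<tau> + s) / c\<^sup>2 * (1 + r\<^sup>2) powr (2 * \<tau> + s)"
proof -
  have p0: "0 < c * r powr (- \<tau>)" using assms by simp
  then have "0 < p" using p by linarith
  have "(1 + \<epsilon> * r) powr (s + \<tau>) / p \<le> (1 + r) powr (s + \<tau>) / (c * r powr (- \<tau>))"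
    using assms p0 by (intro frac_le powr_mono2) (auto simp: mult_left_le_one_le)
  also have "\<dots> = (1 + r) powr (s + \<tau>) * r powr \<tau> / c"
    using assms by (simp add: powr_minus field_simps)
  also have "\<dots> \<le> (1 + r) powr (s + \<tau>) * (1 + r) powr \<tau> / c"
    using assms by (intro divide_right_mono mult_left_mono powr_mono2) auto
  also have "\<dots> = (1 + r) powr (2 * \<tau> + s) / c"
    by (simp add: powr_add[symmetric] algebra_simps)
  finally have "((1 + \<epsilon> * r) powr (s + \<tau>) / p)\<^sup>2 \<le> ((1 + r) powr (2 * \<tau> + s) / c)\<^sup>2"
    using assms \<open>0 < p\<close> by (intro power_mono) auto
  also have "\<dots> = ((1 + r)\<^sup>2) powr (2 * \<tau> + s) / c\<^sup>2"
    using assms by (simp add: power_divide power2_eq_square powr_mult)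
  \<comment> \<open>Nonnegativity of the square of \<open>r - 1\<close>.\<close>
  also have "\<dots> \<le> (2 * (1 + r\<^sup>2)) powr (2 * \<tau> + s) / c\<^sup>2"
    using assms zero_le_power2[of "r - 1"]
    by (intro divide_right_mono powr_mono2) (auto simp: power2_eq_square algebra_simps)
  also have "\<dots> = 2 powr (2 * \<tau> + s) / c\<^sup>2 * (1 + r\<^sup>2) powr (2 * \<tau> + s)"
    by (simp only: powr_mult times_divide_eq_left)
  finally show ?thesis .
qed

text \<open>With \<open>r\<close> and \<open>p\<close> read as before, the lower bound on
  \<open>p\<close> costs \<open>\<tau>\<close> of the order \<open>s + \<tau>\<close>, leaving order
  \<open>s\<close> for \<open>U = w / p\<close>.\<close>

lemma sobolev_weight_solution:
  fixes r p c s \<tau> \<epsilon> :: real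
  assumes "0 < r" "0 < c" "0 \<le> s" "0 < \<tau>" "0 < \<epsilon>" "\<epsilon> \<le> 1" and p: "c * r powr (- \<tau>) \<le> p"
  shows "(1 + r\<^sup>2) powr s \<le> (\<epsilon> powr (- (s + \<tau>)) / c)\<^sup>2 * ((1 + \<epsilon> * r) powr (s + \<tau>) * p)\<^sup>2"
proof -
  have "(1 + r\<^sup>2) powr s \<le> ((1 + r)\<^sup>2) powr s"
    using assms by (intro powr_mono2) (auto simp: power2_eq_square algebra_simps)
  also have "\<dots> = ((1 + r) powr s)\<^sup>2"
    using assms by (simp add: power2_eq_square powr_mult)
  also have "\<dots> \<le> (\<epsilon> powr (- (s + \<tau>)) / c * ((1 + \<epsilon> * r) powr (s + \<tau>) * p))\<^sup>2"
  proof (rule power_mono)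
    have "(1 + r) powr s * r powr \<tau> \<le> (1 + r) powr s * (1 + r) powr \<tau>"
      using assms by (intro mult_left_mono powr_mono2) auto
    also have "\<dots> = \<epsilon> powr (- (s + \<tau>)) * (\<epsilon> * (1 + r)) powr (s + \<tau>)"
      using assms by (simp add: powr_mult powr_add[symmetric] powr_minus)
    \<comment> \<open>\<open>\<epsilon> \<le> 1\<close> gives
      \<open>\<epsilon> * (1 + r) \<le> 1 + \<epsilon> * r\<close>; the negative power of
      \<open>\<epsilon>\<close> is the price of using the slow weight.\<close>
    also have "\<dots> \<le> \<epsilon> powr (- (s + \<tau>)) * (1 + \<epsilon> * r) powr (s + \<tau>)"
      using assms by (intro mult_left_mono powr_mono2) (auto simp: algebra_simps)
    finally have "(1 + r) powr s * r powr \<tau> * r powr (- \<tau>) \<le> \<epsilon> powr (- (s + \<tau>)) * (1 + \<epsilon> * r) powr (s + \<tau>) * r powr (- \<tau>)"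
      by (rule mult_right_mono) simp
    also have "(1 + r) powr s * r powr \<tau> * r powr (- \<tau>) = (1 + r) powr s"
      using assms by (simp add: powr_minus)
    also have "\<epsilon> powr (- (s + \<tau>)) * (1 + \<epsilon> * r) powr (s + \<tau>) * r powr (- \<tau>)
        = \<epsilon> powr (- (s + \<tau>)) / c * ((1 + \<epsilon> * r) powr (s + \<tau>) * (c * r powr (- \<tau>)))"
      using assms by simp
    also have "\<dots> \<le> \<epsilon> powr (- (s + \<tau>)) / c * ((1 + \<epsilon> * r) powr (s + \<tau>) * p)"
      using assms by (intro mult_left_mono) auto
    finally show "(1 + r) powr s \<le> \<epsilon> powr (- (s + \<tau>)) / c * ((1 + \<epsilon> * r) powr (s + \<tau>) * p)" .
  qed simp
  finally show ?thesis by (simp only: power_mult_distrib)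
qed

theorem theorem3p3:
  fixes P :: "real ^ 'n ^ 'd"
    and A :: "real ^ 'n \<Rightarrow> real"
    and s \<alpha>\<^sub>0 \<alpha>\<^sub>1 C\<^sub>A N c \<tau> :: real
    and F :: "int ^ 'n \<Rightarrow> complex"
  assumes "rat_independent_columns P"
    and "s \<ge> 0"
    and "torus_periodic A" and "A \<in> borel_measurable lebesgue"
    and "0 < \<alpha>\<^sub>0" and "\<And>y. \<alpha>\<^sub>0 \<le> A y" and "\<And>y. A y \<le> \<alpha>\<^sub>1"
    and "C\<^sub>A > 0" and "N > real CARD('n) + s + \<tau>"
    and "\<And>k. cmod (fourier_coeff (\<lambda>y. complex_of_real (A y)) k)
               \<le> C\<^sub>A * (1 + norm (of_int_vec k)) powr (- N)"
    and "c > 0" and "\<tau> > 0"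
    and "\<And>k. k \<noteq> 0 \<Longrightarrow> norm (P *v of_int_vec k) \<ge> c * norm (of_int_vec k) powr (- \<tau>)"
    and "F \<in> H_0 (2 * \<tau> + s)"
  shows "\<exists>!U. U \<in> H_0 s \<and> variational_solution A P F U"
proof -
  have norm_pos: "0 < norm (of_int_vec k)" if "k \<noteq> 0" for k :: "int ^ 'n"
    using that by simp
  \<comment> \<open>The Diophantine bound keeps \<open>P k\<close> away from 0, and
    \<open>N > n + s + \<tau>\<close> exceeds the dimension, so the decay bound is a summable
    majorant.\<close>
  interpret variational_problem P A \<alpha>\<^sub>0 \<alpha>\<^sub>1 "\<lambda>k. C\<^sub>A * (1 + norm (of_int_vec k)) powr (- N)"
  proof
    show "P *v of_int_vec k \<noteq> 0" if k: "k \<noteq> 0" for k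
    proof -
      have "0 < c * norm (of_int_vec k) powr (- \<tau>)"
        using \<open>c > 0\<close> norm_pos[OF k] by simp
      also have "\<dots> \<le> norm (P *v of_int_vec k)" by (rule assms(13)[OF k])
      finally show ?thesis by auto
    qed
    show "(\<lambda>k. C\<^sub>A * (1 + norm (of_int_vec k)) powr (- N)) summable_on (UNIV :: (int ^ 'n) set)"
      using assms(2,9,12) by (intro summable_on_cmult_right summable_on_lattice_powr) linarith
  qed (use assms in auto)
  \<comment> \<open>With weight exponent \<open>s + \<tau>\<close> the decay required there is
    exactly \<open>N > n + s + \<tau>\<close>.\<close>
  obtain \<epsilon> where \<epsilon>: "0 < \<epsilon>" "\<epsilon> \<le> 1"
    and solve: "\<And>g :: int ^ 'n \<Rightarrow> complex. (\<lambda>k. (cmod (weight \<epsilon> (s + \<tau>) k * g k))\<^sup>2) summable_on (- {0}) \<Longrightarrow>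
      \<exists>w :: int ^ 'n \<Rightarrow> complex. (\<lambda>k. (cmod (weight \<epsilon> (s + \<tau>) k * w k))\<^sup>2) summable_on (- {0})
        \<and> (\<forall>k. k \<noteq> 0 \<longrightarrow> (\<Sum>\<^sub>\<infinity>l\<in>- {0}. M k l * w l) = g k)"
    by (rule ex_weighted_solution[of C\<^sub>A N "s + \<tau>"]) (use assms in auto)
  have low: "c * norm (of_int_vec k) powr (- \<tau>) \<le> freq k" if "k \<noteq> 0" for k
    unfolding freq_def by (rule assms(13)[OF that])
  have "(\<lambda>k. (cmod (weight \<epsilon> (s + \<tau>) k * (F k / freq k)))\<^sup>2) summable_on (- {0})"
  proof (rule summable_on_comparison_test)
    show "(\<lambda>k. 2 powr (2 * \<tau> + s) / c\<^sup>2 * ((1 + (norm (of_int_vec k))\<^sup>2) powr (2 * \<tau> + s) * (cmod (F k))\<^sup>2)) summable_on (- {0})"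
      using assms(14) by (intro summable_on_cmult_right) (simp add: H_0_def)
    fix k :: "int ^ 'n" assume "k \<in> - {0}"
    then have k: "k \<noteq> 0" by simp
    have "(cmod (weight \<epsilon> (s + \<tau>) k * (F k / freq k)))\<^sup>2 = (weight \<epsilon> (s + \<tau>) k / freq k)\<^sup>2 * (cmod (F k))\<^sup>2"
      by (simp add: norm_mult norm_divide power_mult_distrib power_divide)
    also have "\<dots> \<le> (2 powr (2 * \<tau> + s) / c\<^sup>2 * (1 + (norm (of_int_vec k))\<^sup>2) powr (2 * \<tau> + s)) * (cmod (F k))\<^sup>2"
      unfolding weight_def using assms(2,11,12) \<epsilon>
      by (intro mult_right_mono sobolev_weight_source norm_pos low k) auto
    finally show "(cmod (weight \<epsilon> (s + \<tau>) k * (F k / freq k)))\<^sup>2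
        \<le> 2 powr (2 * \<tau> + s) / c\<^sup>2 * ((1 + (norm (of_int_vec k))\<^sup>2) powr (2 * \<tau> + s) * (cmod (F k))\<^sup>2)"
      by (simp only: mult.assoc)
  qed simp
  from solve[OF this] obtain w :: "int ^ 'n \<Rightarrow> complex" where
    w: "(\<lambda>k. (cmod (weight \<epsilon> (s + \<tau>) k * w k))\<^sup>2) summable_on (- {0})"
    and Mw: "\<And>k. k \<noteq> 0 \<Longrightarrow> (\<Sum>\<^sub>\<infinity>l\<in>- {0}. M k l * w l) = F k / freq k"
    by blast
  \<comment> \<open>The zero mode is set to 0, as membership in both spaces demands.\<close>
  define U where "U k = (if k = 0 then 0 else w k / freq k)" for k
  have fU: "freq k * U k = w k" if "k \<noteq> 0" for k
    using freq_pos[OF that] that by (simp add: U_def)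
  have "(\<lambda>k. (cmod (norm (P *v of_int_vec k) * U k))\<^sup>2) summable_on (- {0})"
  proof (rule summable_on_comparison_test[OF w])
    fix k :: "int ^ 'n" assume "k \<in> - {0}"
    then have k: "k \<noteq> 0" by simp
    \<comment> \<open>The weight is at least 1, so weighted summability of \<open>w\<close> implies
      plain summability, which is finite energy of \<open>U\<close>.\<close>
    have "1 * cmod (w k) \<le> weight \<epsilon> (s + \<tau>) k * cmod (w k)"
      using \<epsilon> assms(2,12) by (intro mult_right_mono weight_ge_1) auto
    also have "\<dots> \<le> cmod (weight \<epsilon> (s + \<tau>) k * w k)" by (simp add: norm_mult mult_right_mono)
    finally show "(cmod (norm (P *v of_int_vec k) * U k))\<^sup>2 \<le> (cmod (weight \<epsilon> (s + \<tau>) k * w k))\<^sup>2"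
      using fU[OF k] by (intro power_mono) (auto simp: freq_def)
  qed simp
  then have U_bar: "U \<in> H_bar_0 P 1" by (simp add: H_bar_0_1_iff U_def)
  have "(\<lambda>k. (1 + (norm (of_int_vec k))\<^sup>2) powr s * (cmod (U k))\<^sup>2) summable_on (- {0})"
  proof (rule summable_on_comparison_test[OF summable_on_cmult_right[OF w]])
    fix k :: "int ^ 'n" assume "k \<in> - {0}"
    then have k: "k \<noteq> 0" by simp
    have "(1 + (norm (of_int_vec k))\<^sup>2) powr s * (cmod (U k))\<^sup>2
        \<le> ((\<epsilon> powr (- (s + \<tau>)) / c)\<^sup>2 * (weight \<epsilon> (s + \<tau>) k * freq k)\<^sup>2) * (cmod (U k))\<^sup>2"
      unfolding weight_def using assms(2,11,12) \<epsilon>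
      by (intro mult_right_mono sobolev_weight_solution norm_pos low k) auto
    also have "\<dots> = (\<epsilon> powr (- (s + \<tau>)) / c)\<^sup>2 * (cmod (weight \<epsilon> (s + \<tau>) k * w k))\<^sup>2"
      unfolding fU[OF k, symmetric] by (simp add: norm_mult power_mult_distrib)
    finally show "(1 + (norm (of_int_vec k))\<^sup>2) powr s * (cmod (U k))\<^sup>2
        \<le> (\<epsilon> powr (- (s + \<tau>)) / c)\<^sup>2 * (cmod (weight \<epsilon> (s + \<tau>) k * w k))\<^sup>2" .
  qed simp
  then have "U \<in> H_0 s" by (simp add: H_0_def U_def)
  moreover have "variational_solution A P F U"
    unfolding variational_solution_iff[OF U_bar]
  proof (intro allI impI)
    fix k :: "int ^ 'n" assume k: "k \<noteq> 0"
    have "(\<Sum>\<^sub>\<infinity>l\<in>- {0}. M k l * (freq l * U l)) = (\<Sum>\<^sub>\<infinity>l\<in>- {0}. M k l * w l)"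
      by (intro infsum_cong) (simp add: fU)
    then show "(\<Sum>\<^sub>\<infinity>l\<in>- {0}. M k l * (freq l * U l)) = F k / freq k"
      using Mw[OF k] by simp
  qed
  ultimately show ?thesis using variational_solution_unique by blast
qed

end
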